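(* (1) Let $\mathcal P$ be a chiral or directly regular polytope. Then $\mathcal P \diamond \mathcal P^{\delta}$ is properly self-dual. (2) Let $\mathcal P$ be a chiral polytope and let $\mathcal Q = \mathcal P \diamond \overline{\mathcal P^{\delta}}$. Then $\mathcal Q = \overline{\mathcal Q^{\delta}}$; if $\mathcal Q$ is directly regular then it is (properly) self-dual, and if $\mathcal Q$ is chiral then it is improperly self-dual.
   Context: An abstract polytope of rank $n$ (an $n$-polytope) is a ranked poset of faces with ranks from $-1$ to $n$, with a unique least face (rank $-1$) and a unique greatest face (rank $n$), in which every flag (maximal chain) has $n+2$ faces, which satisfies the diamond condition (whenever $F<G$ with ranks $j-1$ and $j+1$ there are exactly two $j$-faces strictly between them), and which is strongly flag-connected (any two flags $\Phi,\Psi$ are joined by a sequence of flags, consecutive ones adjacent, all containing $\Phi\cap\Psi$; two flags are adjacent if they differ in exactly one face). $\Phi^j$ denotes the unique flag differing from $\Phi$ only in its $j$-face, and $\Phi^{i,j}=(\Phi^i)^j$. Each polytope considered has a fixed base flag $\Phi$. $\mathcal P$ is regular if its automorphism group $\Gamma(\mathcal P)$ is transitive on flags; then $\Gamma(\mathcal P)$ is generated by $\rho_0,\dots,\rho_{n-1}$, where $\rho_i$ maps $\Phi$ to $\Phi^i$. Put $\sigma_i=\rho_{i-1}\rho_i$ and $\Gamma^+(\mathcal P)=\langle\sigma_1,\dots,\sigma_{n-1}\rangle$; $\mathcal P$ is directly regular if it is regular and $\Gamma^+(\mathcal P)$ has index $2$ in $\Gamma(\mathcal P)$. $\mathcal P$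 is chiral if $\Gamma(\mathcal P)$ has exactly two orbits on flags and adjacent flags lie in distinct orbits; then $\Gamma^+(\mathcal P):=\Gamma(\mathcal P)$ is generated by $\sigma_1,\dots,\sigma_{n-1}$, where $\sigma_i$ maps $\Phi$ to $\Phi^{i,i-1}$. In both cases $(\sigma_i\cdots\sigma_j)^2=1$ for $i<j$. Let $W^+=\langle \sigma_1,\dots,\sigma_{n-1}\mid (\sigma_i\cdots\sigma_j)^2=1 \text{ for } 1\le i<j\le n-1\rangle$. Writing $\Gamma^+(\mathcal P)=W^+/M$ means that $M$ is the kernel of the epimorphism $W^+\to\Gamma^+(\mathcal P)$ preserving the specified generators. For $w\in W^+$, $\overline w$ is obtained by replacing $\sigma_1$ by $\sigma_1^{-1}$, $\sigma_2$ by $\sigma_1^2\sigma_2$ and fixing $\sigma_j$ for $j\ge3$; $\delta(w)$ is obtained by replacing each $\sigma_i$ by $\sigma_{n-i}^{-1}$ (both are automorphisms of $W^+$). For $M\trianglelefteq W^+$ put $\overline M=\{\overline w: w\in M\}$, $\delta(M)=\{\delta(w):w\in M\}$; one has $\delta(\overline M)=\overline{\delta(M)}$. If $\Gamma^+(\mathcal P)=W^+/M$, then the dual $\mathcal P^\delta$ (reversed partial order) has $\Gamma^+(\mathcal P^\delta)=W^+/\delta(M)$; $\mathcal P$ is directly regular if $\overline M=M$ and chiral otherwise; and the mirror image $\overline{\mathcal P}$ of a chiral $\mathcal P$ (same faces, base flag $\Phi^0$) has $\Gamma^+(\overline{\mathcal P})=W^+/\overline M$. Mix: $\mathcal P\diamond\mathcal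 Q$ denotes the flag-connected pre-polytope (polytope axioms with strong flag-connectedness weakened to flag-connectedness) built from the group $\Gamma^+(\mathcal P)\diamond\Gamma^+(\mathcal Q)$, the subgroup of $\Gamma^+(\mathcal P)\times\Gamma^+(\mathcal Q)$ with specified generators $\beta_i=(\sigma_i,\sigma_i')$. It is handled through its rotation group $\Gamma^+(\mathcal P\diamond\mathcal Q)=\Gamma^+(\mathcal P)\diamond\Gamma^+(\mathcal Q)=W^+/N$: it is directly regular if $\overline N=N$ and chiral otherwise; equality of two such structures means equality of the corresponding normal subgroups of $W^+$, and dual and mirror image correspond to $\delta(N)$ and $\overline N$. Such a structure is properly self-dual if $\delta(N)=N$ (equivalently there is a duality, i.e. order-reversing bijection, fixing the base flag); a chiral one is improperly self-dual if $\delta(N)=\overline N$ (it is self-dual, but no duality fixes the base flag). *)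

theory Defs
  imports "HOL-Algebra.Group_Action" "HOL-Algebra.Generated_Groups"
begin

section \<open>Abstract polytopes with a base flag\<close>

record 'a based_poset =
  face_le :: "'a rel"
  rk :: "'a \<Rightarrow> int"
  base :: "'a set"

definition faces :: "'a based_poset \<Rightarrow> 'a set" where
  "faces P = Field (face_le P)"

definition face_less :: "'a based_poset \<Rightarrow> 'a \<Rightarrow> 'a \<Rightarrow> bool" where
  "face_less P F G \<longleftrightarrow> (F, G) \<in> face_le P \<and> F \<noteq> G"

definition flags :: "'a based_poset \<Rightarrow> 'a set set" where
  "flags P = {C \<in> Chains (face_le P). \<forall>D \<in> Chains (face_le P). C \<subseteq> D \<longrightarrow> C = D}"

definition adjacent :: "'a set \<Rightarrow> 'a set \<Rightarrow> bool" where
  "adjacent A B \<longleftrightarrow> card (A - B) = 1 \<and> card (B - A) = 1"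

definition strongly_flag_connected :: "'a based_poset \<Rightarrow> bool" where
  "strongly_flag_connected P \<longleftrightarrow>
     (\<forall>\<Phi> \<in> flags P. \<forall>\<Psi> \<in> flags P.
        (\<Phi>, \<Psi>) \<in> {(A, B). A \<in> flags P \<and> B \<in> flags P \<and> adjacent A B \<and>
                        \<Phi> \<inter> \<Psi> \<subseteq> A \<and> \<Phi> \<inter> \<Psi> \<subseteq> B}\<^sup>*)"

text \<open>Together with the flag condition, strict monotonicity of the rank function forces each
  flag to contain exactly one face of each rank, so ranks increase by one along covers.\<close>

definition polytope :: "nat \<Rightarrow> 'a based_poset \<Rightarrow> bool" where
  "polytope n P \<longleftrightarrow>
     Partial_order (face_le P) \<and>
     (\<forall>F \<in> faces P. - 1 \<le> rk P F \<and> rk P F \<le> int n) \<and>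
     (\<forall>F G. face_less P F G \<longrightarrow> rk P F < rk P G) \<and>
     (\<exists>!F. F \<in> faces P \<and> rk P F = - 1 \<and> (\<forall>G \<in> faces P. (F, G) \<in> face_le P)) \<and>
     (\<exists>!F. F \<in> faces P \<and> rk P F = int n \<and> (\<forall>G \<in> faces P. (G, F) \<in> face_le P)) \<and>
     (\<forall>\<Psi> \<in> flags P. card \<Psi> = n + 2) \<and>
     (\<forall>F G. face_less P F G \<and> rk P G = rk P F + 2 \<longrightarrow>
        card {H. rk P H = rk P F + 1 \<and> face_less P F H \<and> face_less P H G} = 2) \<and>
     strongly_flag_connected P \<and>
     base P \<in> flags P"

definition flag_adj :: "'a based_poset \<Rightarrow> nat \<Rightarrow> 'a set \<Rightarrow> 'a set" where
  "flag_adj P j \<Psi> =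
     (THE \<Psi>'. \<Psi>' \<in> flags P \<and> \<Psi>' \<noteq> \<Psi> \<and>
        {F \<in> \<Psi>'. rk P F \<noteq> int j} = {F \<in> \<Psi>. rk P F \<noteq> int j})"

definition dual :: "nat \<Rightarrow> 'a based_poset \<Rightarrow> 'a based_poset" where
  "dual n P = \<lparr>face_le = (face_le P)\<inverse>, rk = (\<lambda>F. int n - 1 - rk P F), base = base P\<rparr>"

definition mirror :: "'a based_poset \<Rightarrow> 'a based_poset" where
  "mirror P = P\<lparr>base := flag_adj P 0 (base P)\<rparr>"


section \<open>Automorphism groups and rotation groups\<close>

text \<open>Automorphisms act on the right: the product \<open>f \<otimes> g\<close> is \<open>f\<close> followed by \<open>g\<close>. Under this
  convention \<open>\<rho>\<^bsub>i-1\<^esub>\<rho>\<^bsub>i\<^esub>\<close> maps the base flag \<open>\<Phi>\<close> to \<open>\<Phi>\<^bsup>i,i-1\<^esup>\<close>, in agreement with the chiral case.\<close>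

definition aut_group :: "'a based_poset \<Rightarrow> ('a \<Rightarrow> 'a) monoid" where
  "aut_group P =
     \<lparr>carrier = {f \<in> Bij (faces P). \<forall>F \<in> faces P. \<forall>G \<in> faces P.
                   (F, G) \<in> face_le P \<longleftrightarrow> (f F, f G) \<in> face_le P},
      monoid.mult = (\<lambda>f g. compose (faces P) g f),
      one = (\<lambda>F \<in> faces P. F)\<rparr>"

definition regular :: "'a based_poset \<Rightarrow> bool" where
  "regular P \<longleftrightarrow>
     (\<forall>\<Phi> \<in> flags P. \<forall>\<Psi> \<in> flags P. \<exists>f \<in> carrier (aut_group P). f ` \<Phi> = \<Psi>)"

definition base_to :: "'a based_poset \<Rightarrow> 'a set \<Rightarrow> 'a \<Rightarrow> 'a" where
  "base_to P \<Psi> = (THE f. f \<in> carrier (aut_group P) \<and> f ` base P = \<Psi>)"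

definition rho :: "'a based_poset \<Rightarrow> nat \<Rightarrow> 'a \<Rightarrow> 'a" where
  "rho P i = base_to P (flag_adj P i (base P))"

definition sigma :: "'a based_poset \<Rightarrow> nat \<Rightarrow> 'a \<Rightarrow> 'a" where
  "sigma P i =
     (if regular P then rho P (i - 1) \<otimes>\<^bsub>aut_group P\<^esub> rho P i
      else base_to P (flag_adj P (i - 1) (flag_adj P i (base P))))"

definition rot_group :: "nat \<Rightarrow> 'a based_poset \<Rightarrow> ('a \<Rightarrow> 'a) monoid" where
  "rot_group n P =
     (if regular P
      then (aut_group P)\<lparr>carrier := generate (aut_group P) (sigma P ` {1..<n})\<rparr>
      else aut_group P)"

definition directly_regular_polytope :: "nat \<Rightarrow> 'a based_poset \<Rightarrow> bool" where
  "directly_regular_polytope n P \<longleftrightarrow>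
     polytope n P \<and> regular P \<and>
     card (rcosets\<^bsub>aut_group P\<^esub> (carrier (rot_group n P))) = 2"

definition chiral_polytope :: "nat \<Rightarrow> 'a based_poset \<Rightarrow> bool" where
  "chiral_polytope n P \<longleftrightarrow>
     polytope n P \<and>
     card (orbits (aut_group P) (flags P) (`)) = 2 \<and>
     (\<forall>A \<in> flags P. \<forall>B \<in> flags P. adjacent A B \<longrightarrow>
        orbit (aut_group P) (`) A \<noteq> orbit (aut_group P) (`) B)"


section \<open>Groups given by generators and relations\<close>

text \<open>The letter \<open>(i, True)\<close> stands for the \<open>i\<close>-th generator and \<open>(i, False)\<close> for its inverse.\<close>

type_synonym word = "(nat \<times> bool) list"

definition words :: "nat set \<Rightarrow> word set" where
  "words I = lists (I \<times> UNIV)"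

inductive_set pres_rel :: "nat set \<Rightarrow> word set \<Rightarrow> word rel"
  for I :: "nat set" and R :: "word set"
where
  pres_refl: "u \<in> words I \<Longrightarrow> (u, u) \<in> pres_rel I R"
| pres_sym: "(u, v) \<in> pres_rel I R \<Longrightarrow> (v, u) \<in> pres_rel I R"
| pres_trans: "(u, v) \<in> pres_rel I R \<Longrightarrow> (v, w) \<in> pres_rel I R \<Longrightarrow> (u, w) \<in> pres_rel I R"
| pres_cancel: "u \<in> words I \<Longrightarrow> v \<in> words I \<Longrightarrow> i \<in> I \<Longrightarrow>
    (u @ [(i, b), (i, \<not> b)] @ v, u @ v) \<in> pres_rel I R"
| pres_relator: "u \<in> words I \<Longrightarrow> v \<in> words I \<Longrightarrow> r \<in> R \<Longrightarrow>
    (u @ r @ v, u @ v) \<in> pres_rel I R"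

definition presented_group :: "nat set \<Rightarrow> word set \<Rightarrow> word set monoid" where
  "presented_group I R =
     \<lparr>carrier = words I // pres_rel I R,
      monoid.mult = (\<lambda>A B. \<Union>u \<in> A. \<Union>v \<in> B. pres_rel I R `` {u @ v}),
      one = pres_rel I R `` {[]}\<rparr>"

definition word_eval :: "('g, 'm) monoid_scheme \<Rightarrow> (nat \<Rightarrow> 'g) \<Rightarrow> word \<Rightarrow> 'g" where
  "word_eval G g w =
     foldr (\<lambda>(i, b) x. (if b then g i else inv\<^bsub>G\<^esub> (g i)) \<otimes>\<^bsub>G\<^esub> x) w \<one>\<^bsub>G\<^esub>"

text \<open>The homomorphism from a presented group to \<open>G\<close> that sends the \<open>i\<close>-th generator to \<open>g i\<close>;
  it is meaningful when the elements \<open>g i\<close> satisfy the relations, so that \<open>word_eval G g\<close> is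
  constant on each class of words.\<close>

definition gen_hom :: "('g, 'm) monoid_scheme \<Rightarrow> (nat \<Rightarrow> 'g) \<Rightarrow> word set \<Rightarrow> 'g" where
  "gen_hom G g A = the_elem (word_eval G g ` A)"


section \<open>The group $W^+$\<close>

definition W_relators :: "nat \<Rightarrow> word set" where
  "W_relators n =
     {concat (replicate 2 (map (\<lambda>k. (k, True)) [i..<Suc j])) | i j. 1 \<le> i \<and> i < j \<and> j < n}"

definition W :: "nat \<Rightarrow> word set monoid" where
  "W n = presented_group {1..<n} (W_relators n)"

definition W_gen :: "nat \<Rightarrow> nat \<Rightarrow> word set" where
  "W_gen n i = pres_rel {1..<n} (W_relators n) `` {[(i, True)]}"

definition W_bar :: "nat \<Rightarrow> word set \<Rightarrow> word set" where
  "W_bar n = gen_hom (W n)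
     (\<lambda>i. if i = 1 then inv\<^bsub>W n\<^esub> (W_gen n 1)
          else if i = 2 then W_gen n 1 [^]\<^bsub>W n\<^esub> (2::nat) \<otimes>\<^bsub>W n\<^esub> W_gen n 2
          else W_gen n i)"

definition W_delta :: "nat \<Rightarrow> word set \<Rightarrow> word set" where
  "W_delta n = gen_hom (W n) (\<lambda>i. inv\<^bsub>W n\<^esub> (W_gen n (n - i)))"


section \<open>Mixes\<close>

definition mix_gen :: "'a based_poset \<Rightarrow> 'b based_poset \<Rightarrow> nat \<Rightarrow> ('a \<Rightarrow> 'a) \<times> ('b \<Rightarrow> 'b)" where
  "mix_gen P Q i = (sigma P i, sigma Q i)"

definition mix_group ::
  "nat \<Rightarrow> 'a based_poset \<Rightarrow> 'b based_poset \<Rightarrow> (('a \<Rightarrow> 'a) \<times> ('b \<Rightarrow> 'b)) monoid" where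
  "mix_group n P Q =
     (rot_group n P \<times>\<times> rot_group n Q)
       \<lparr>carrier := generate (rot_group n P \<times>\<times> rot_group n Q) (mix_gen P Q ` {1..<n})\<rparr>"

text \<open>The mix of two polytopes is a pre-polytope that is determined by its rotation group
  \<open>W\<^sup>+ / N\<close>; it is represented here by the normal subgroup \<open>N\<close> of \<open>W\<^sup>+\<close>. The predicates and
  operations below are those of such structures, with \<open>N\<close> standing for the structure.\<close>

definition mix :: "nat \<Rightarrow> 'a based_poset \<Rightarrow> 'b based_poset \<Rightarrow> word set set" where
  "mix n P Q = kernel (W n) (mix_group n P Q) (gen_hom (mix_group n P Q) (mix_gen P Q))"

definition struct_mirror :: "nat \<Rightarrow> word set set \<Rightarrow> word set set" where
  "struct_mirror n N = W_bar n ` N"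

definition struct_dual :: "nat \<Rightarrow> word set set \<Rightarrow> word set set" where
  "struct_dual n N = W_delta n ` N"

definition struct_directly_regular :: "nat \<Rightarrow> word set set \<Rightarrow> bool" where
  "struct_directly_regular n N \<longleftrightarrow> struct_mirror n N = N"

definition struct_chiral :: "nat \<Rightarrow> word set set \<Rightarrow> bool" where
  "struct_chiral n N \<longleftrightarrow> \<not> struct_directly_regular n N"

definition properly_self_dual :: "nat \<Rightarrow> word set set \<Rightarrow> bool" where
  "properly_self_dual n N \<longleftrightarrow> struct_dual n N = N"

definition improperly_self_dual :: "nat \<Rightarrow> word set set \<Rightarrow> bool" where
  "improperly_self_dual n N \<longleftrightarrow> struct_chiral n N \<and> struct_dual n N = struct_mirror n N"

end

theory Submission
  imports Defs
begin

text \<open>Let \<open>a\<^sub>j\<close> send a flag to its \<open>j\<close>-adjacent flag. A word in the \<open>\<sigma>\<^sub>i\<close> acts on flags by replacing \<open>\<sigma>\<^sub>i\<close> by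
  \<open>a\<^bsub>i-1\<^esub> a\<^sub>i\<close>; this action commutes with all automorphisms, and automorphisms act freely on flags,
  so the kernel \<open>M\<close> of \<open>W\<^sup>+ \<rightarrow> \<Gamma>\<^sup>+(P)\<close> consists of the words that fix the base flag. Passing to the
  dual replaces \<open>M\<close> by \<open>\<delta>(M)\<close>, and moving the base flag to its \<open>0\<close>-adjacent flag replaces \<open>M\<close> by its
  bar, because the bar of a word acts as the conjugate of the word by \<open>a\<^sub>0\<close>. Now \<open>M\<close> depends only on
  the orbit of the base flag, which contains every flag reached from it by two adjacency steps; as
  the \<open>0\<close>- and the \<open>(n-1)\<close>-adjacent flags of the base flag share an orbit, \<open>\<delta>\<close> and bar commute on \<open>M\<close>.
  The two mixes are the intersections of \<open>M\<close> with \<open>\<delta>(M)\<close> and with the bar of \<open>\<delta>(M)\<close>, and \<open>\<delta>\<close>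
  and bar are involutions.\<close>

section \<open>Presented groups\<close>

definition inv_word :: "word \<Rightarrow> word" where
  "inv_word w = rev (map (\<lambda>(i, b). (i, \<not> b)) w)"

definition subst_word :: "(nat \<Rightarrow> word) \<Rightarrow> word \<Rightarrow> word" where
  "subst_word h w = concat (map (\<lambda>(i, b). if b then h i else inv_word (h i)) w)"

lemma words_Nil [simp]: "[] \<in> words I"
  and words_Cons [simp]: "x # w \<in> words I \<longleftrightarrow> fst x \<in> I \<and> w \<in> words I"
  and words_append [simp]: "u @ v \<in> words I \<longleftrightarrow> u \<in> words I \<and> v \<in> words I"
  by (cases x; auto simp: words_def)+

lemma inv_word_simps [simp]:
  "inv_word [] = []" "inv_word ((i, b) # w) = inv_word w @ [(i, \<not> b)]"
  by (auto simp: inv_word_def)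

lemma inv_word_append [simp]: "inv_word (u @ v) = inv_word v @ inv_word u"
  by (simp add: inv_word_def)

lemma inv_word_inv_word [simp]: "inv_word (inv_word w) = w"
  by (induction w) auto

lemma inv_word_in_words [simp]: "inv_word w \<in> words I \<longleftrightarrow> w \<in> words I"
  by (induction w) auto

lemma subst_word_simps [simp]:
  "subst_word h [] = []"
  "subst_word h ((i, b) # w) = (if b then h i else inv_word (h i)) @ subst_word h w"
  by (auto simp: subst_word_def)

lemma subst_word_append [simp]: "subst_word h (u @ v) = subst_word h u @ subst_word h v"
  by (simp add: subst_word_def)

lemma subst_word_inv_word: "subst_word h (inv_word w) = inv_word (subst_word h w)"
  by (induction w) auto

lemma subst_word_subst_word:
  "subst_word h (subst_word k w) = subst_word (\<lambda>i. subst_word h (k i)) w"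
  by (induction w) (auto simp: subst_word_inv_word)

lemma subst_word_letter [simp]: "subst_word (\<lambda>i. [(i, True)]) w = w"
  by (induction w) auto

lemma subst_word_cong:
  assumes "w \<in> words I" and "\<And>i. i \<in> I \<Longrightarrow> h i = k i"
  shows "subst_word h w = subst_word k w"
  using assms(1) by (induction w) (auto simp: assms(2))

lemma subst_word_in_words:
  assumes "w \<in> words I" and "\<And>i. i \<in> I \<Longrightarrow> h i \<in> words J"
  shows "subst_word h w \<in> words J"
  using assms(1) by (induction w) (auto simp: assms(2))

lemma word_eval_simps [simp]:
  "word_eval G g [] = \<one>\<^bsub>G\<^esub>"
  "word_eval G g ((i, b) # w) = (if b then g i else inv\<^bsub>G\<^esub> (g i)) \<otimes>\<^bsub>G\<^esub> word_eval G g w"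
  by (auto simp: word_eval_def)

lemma word_eval_cong:
  assumes "w \<in> words I" and "\<And>i. i \<in> I \<Longrightarrow> g i = h i"
  shows "word_eval G g w = word_eval G h w"
  using assms(1) by (induction w) (auto simp: assms(2))

lemma (in group) word_eval_closed:
  assumes "w \<in> words I" and "\<And>i. i \<in> I \<Longrightarrow> g i \<in> carrier G"
  shows "word_eval G g w \<in> carrier G"
  using assms(1) by (induction w) (auto simp: assms(2))

lemma (in group) word_eval_append:
  assumes "u \<in> words I" and "v \<in> words I" and g: "\<And>i. i \<in> I \<Longrightarrow> g i \<in> carrier G"
  shows "word_eval G g (u @ v) = word_eval G g u \<otimes> word_eval G g v"
  using assms(1)
proof (induction u)
  case Nil
  then show ?case using word_eval_closed[OF assms(2) g] by simp
next
  case (Cons x u)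
  then show ?case
    using word_eval_closed[OF _ g, of u] word_eval_closed[OF assms(2) g] g
    by (cases x) (auto simp: m_assoc)
qed

lemma (in group) word_eval_subgroup:
  assumes H: "subgroup H G" and g: "\<And>i. i \<in> I \<Longrightarrow> g i \<in> H" and w: "w \<in> words I"
  shows "word_eval (G\<lparr>carrier := H\<rparr>) g w = word_eval G g w"
  using w by (induction w) (auto simp: m_inv_consistent[OF H] g)

lemma word_eval_DirProd:
  assumes "group G" and "group H" and w: "w \<in> words I"
    and "\<And>i. i \<in> I \<Longrightarrow> g i \<in> carrier G" and "\<And>i. i \<in> I \<Longrightarrow> h i \<in> carrier H"
  shows "word_eval (G \<times>\<times> H) (\<lambda>i. (g i, h i)) w = (word_eval G g w, word_eval H h w)"
  using w by (induction w) (auto simp: inv_DirProd assms)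

abbreviation word_class :: "nat set \<Rightarrow> word set \<Rightarrow> word \<Rightarrow> word set" where
  "word_class I R w \<equiv> pres_rel I R `` {w}"

locale presentation =
  fixes I :: "nat set" and R :: "word set"
  assumes relators_in_words: "R \<subseteq> words I"
begin

lemma pres_rel_in_words: "(u, v) \<in> pres_rel I R \<Longrightarrow> u \<in> words I \<and> v \<in> words I"
  by (induction rule: pres_rel.induct) (use relators_in_words in auto)

lemma equiv_pres_rel: "equiv (words I) (pres_rel I R)"
proof (rule equivI)
  show "pres_rel I R \<subseteq> words I \<times> words I" using pres_rel_in_words by auto
  show "refl_on (words I) (pres_rel I R)" by (auto simp: refl_on_def intro: pres_refl)
  show "sym (pres_rel I R)" by (auto intro: symI pres_sym)
  show "trans (pres_rel I R)" by (auto intro: transI pres_trans)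
qed

lemma pres_rel_context:
  assumes "(u, v) \<in> pres_rel I R" and "p \<in> words I" and "q \<in> words I"
  shows "(p @ u @ q, p @ v @ q) \<in> pres_rel I R"
  using assms(1)
proof (induction rule: pres_rel.induct)
  case (pres_refl u)
  then show ?case using assms by (auto intro: pres_rel.pres_refl)
next
  case (pres_cancel u v i b)
  then show ?case
    using assms pres_rel.pres_cancel[of "p @ u" I "v @ q" i b R] by simp
next
  case (pres_relator u v r)
  then show ?case
    using assms pres_rel.pres_relator[of "p @ u" I "v @ q" r R] by simp
qed (auto intro: pres_rel.pres_sym pres_rel.pres_trans)

lemma pres_rel_append:
  assumes u: "(u, u') \<in> pres_rel I R" and v: "(v, v') \<in> pres_rel I R"
  shows "(u @ v, u' @ v') \<in> pres_rel I R"
proof -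
  have "(u @ v, u' @ v) \<in> pres_rel I R"
    using pres_rel_context[OF u, of "[]" v] pres_rel_in_words[OF v] by simp
  moreover have "(u' @ v, u' @ v') \<in> pres_rel I R"
    using pres_rel_context[OF v, of u' "[]"] pres_rel_in_words[OF u] by simp
  ultimately show ?thesis by (rule pres_trans)
qed

lemma pres_rel_inv_word_append: "w \<in> words I \<Longrightarrow> (inv_word w @ w, []) \<in> pres_rel I R"
proof (induction w)
  case Nil
  then show ?case by (auto intro: pres_refl)
next
  case (Cons x w)
  obtain i b where x: "x = (i, b)" by force
  have "(inv_word w @ [(i, \<not> b), (i, \<not> \<not> b)] @ w, inv_word w @ w) \<in> pres_rel I R"
    using Cons x by (intro pres_cancel) auto
  then show ?case using Cons x by (auto intro: pres_trans)
qed

lemma carrier_presented_group: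
  "carrier (presented_group I R) = {word_class I R w | w. w \<in> words I}"
  by (auto simp: presented_group_def quotient_def)

lemma word_class_closed: "w \<in> words I \<Longrightarrow> word_class I R w \<in> carrier (presented_group I R)"
  by (auto simp: carrier_presented_group)

lemma one_presented_group: "\<one>\<^bsub>presented_group I R\<^esub> = word_class I R []"
  by (simp add: presented_group_def)

lemma word_class_eq_iff:
  assumes "u \<in> words I" and "v \<in> words I"
  shows "word_class I R u = word_class I R v \<longleftrightarrow> (u, v) \<in> pres_rel I R"
  using eq_equiv_class_iff[OF equiv_pres_rel] assms by simp

lemma word_class_cancel:
  assumes "u \<in> words I" and "v \<in> words I" and "i \<in> I"
  shows "word_class I R (u @ (i, b) # (i, \<not> b) # v) = word_class I R (u @ v)"
  using assms pres_cancel[OF assms] by (simp add: word_class_eq_iff)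

lemma word_class_relator: "r \<in> R \<Longrightarrow> word_class I R r = \<one>\<^bsub>presented_group I R\<^esub>"
  using relators_in_words pres_relator[of "[]" I "[]" r R]
  by (simp add: one_presented_group word_class_eq_iff subset_iff)

lemma word_class_mult:
  assumes u: "u \<in> words I" and v: "v \<in> words I"
  shows "word_class I R u \<otimes>\<^bsub>presented_group I R\<^esub> word_class I R v = word_class I R (u @ v)"
proof -
  have "word_class I R (u' @ v') = word_class I R (u @ v)"
    if "u' \<in> word_class I R u" "v' \<in> word_class I R v" for u' v'
  proof -
    from that have "(u @ v, u' @ v') \<in> pres_rel I R" by (intro pres_rel_append) auto
    then show ?thesis by (metis equiv_class_eq[OF equiv_pres_rel])
  qed
  then have "(\<Union>u' \<in> word_class I R u. \<Union>v' \<in> word_class I R v. word_class I R (u' @ v'))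
      = (\<Union>u' \<in> word_class I R u. \<Union>v' \<in> word_class I R v. word_class I R (u @ v))"
    by (intro SUP_cong refl)
  moreover have "u \<in> word_class I R u" "v \<in> word_class I R v"
    using u v by (auto intro: pres_refl)
  ultimately show ?thesis by (auto simp: presented_group_def)
qed

lemma word_class_inv_word_mult:
  assumes "w \<in> words I"
  shows "word_class I R (inv_word w) \<otimes>\<^bsub>presented_group I R\<^esub> word_class I R w = \<one>\<^bsub>presented_group I R\<^esub>"
  using assms
  by (simp add: word_class_mult one_presented_group word_class_eq_iff pres_rel_inv_word_append)

lemma group_presented_group: "group (presented_group I R)"
proof (rule groupI)
  show "\<one>\<^bsub>presented_group I R\<^esub> \<in> carrier (presented_group I R)"
    by (simp add: one_presented_group word_class_closed)
next
  fix x y assume "x \<in> carrier (presented_group I R)" "y \<in> carrier (presented_group I R)"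
  then obtain u v where "u \<in> words I" "v \<in> words I" "x = word_class I R u" "y = word_class I R v"
    by (auto simp: carrier_presented_group)
  then show "x \<otimes>\<^bsub>presented_group I R\<^esub> y \<in> carrier (presented_group I R)"
    by (simp add: word_class_mult word_class_closed)
next
  fix x assume "x \<in> carrier (presented_group I R)"
  then obtain w where "w \<in> words I" "x = word_class I R w"
    by (auto simp: carrier_presented_group)
  then show "\<exists>y\<in>carrier (presented_group I R). y \<otimes>\<^bsub>presented_group I R\<^esub> x = \<one>\<^bsub>presented_group I R\<^esub>"
    using word_class_inv_word_mult word_class_closed[of "inv_word w"] by auto
qed (auto simp: carrier_presented_group one_presented_group word_class_mult)

sublocale group "presented_group I R"
  by (rule group_presented_group)

lemma inv_word_class:
  assumes "w \<in> words I"
  shows "inv\<^bsub>presented_group I R\<^esub> (word_class I R w) = word_class I R (inv_word w)"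
  using assms by (intro inv_equality word_class_inv_word_mult word_class_closed) auto

lemma word_eval_word_class:
  assumes "w \<in> words J" and h: "\<And>j. j \<in> J \<Longrightarrow> h j \<in> words I"
  shows "word_eval (presented_group I R) (\<lambda>j. word_class I R (h j)) w =
    word_class I R (subst_word h w)"
  using assms(1)
proof (induction w)
  case Nil
  then show ?case by (simp add: one_presented_group)
next
  case (Cons x w)
  obtain j b where x: "x = (j, b)" by force
  then have "h j \<in> words I" "subst_word h w \<in> words I"
    using Cons.prems h by (auto intro: subst_word_in_words)
  then show ?case using Cons x by (auto simp: word_class_mult inv_word_class)
qed

lemma word_class_subst_word_cong:
  assumes "w \<in> words J"
    and "\<And>j. j \<in> J \<Longrightarrow> h j \<in> words I" and "\<And>j. j \<in> J \<Longrightarrow> k j \<in> words I"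
    and "\<And>j. j \<in> J \<Longrightarrow> word_class I R (h j) = word_class I R (k j)"
  shows "word_class I R (subst_word h w) = word_class I R (subst_word k w)"
proof -
  have "word_class I R (subst_word h w) =
      word_eval (presented_group I R) (\<lambda>j. word_class I R (h j)) w"
    using assms(1,2) by (rule word_eval_word_class[symmetric])
  also have "\<dots> = word_eval (presented_group I R) (\<lambda>j. word_class I R (k j)) w"
    using assms(1,4) by (rule word_eval_cong)
  also have "\<dots> = word_class I R (subst_word k w)"
    using assms(1,3) by (rule word_eval_word_class)
  finally show ?thesis .
qed

end

locale relations_hold = presentation I R + G: group G
  for I :: "nat set" and R :: "word set" and G :: "('g, 'm) monoid_scheme" +
  fixes g :: "nat \<Rightarrow> 'g"
  assumes gen_closed: "i \<in> I \<Longrightarrow> g i \<in> carrier G"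
    and relator_trivial: "r \<in> R \<Longrightarrow> word_eval G g r = \<one>\<^bsub>G\<^esub>"
begin

lemma word_eval_pres_rel: "(u, v) \<in> pres_rel I R \<Longrightarrow> word_eval G g u = word_eval G g v"
proof (induction rule: pres_rel.induct)
  case (pres_cancel u v i b)
  have "word_eval G g ((i, b) # (i, \<not> b) # v) = word_eval G g v"
    using gen_closed[OF pres_cancel(3)] G.word_eval_closed[OF pres_cancel(2) gen_closed]
    by (auto simp flip: G.m_assoc)
  then show ?case using pres_cancel gen_closed
    by (simp add: G.word_eval_append[where I = I] del: word_eval_simps)
next
  case (pres_relator u v r)
  then have "r \<in> words I" using relators_in_words by auto
  with pres_relator show ?case
    using relator_trivial gen_closed G.word_eval_closed[OF pres_relator(2) gen_closed]
    by (simp add: G.word_eval_append[where I = I])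
qed auto

lemma gen_hom_word_class:
  assumes w: "w \<in> words I"
  shows "gen_hom G g (word_class I R w) = word_eval G g w"
proof -
  have "word_eval G g ` word_class I R w = {word_eval G g w}"
    using word_eval_pres_rel pres_refl[OF w] by fastforce
  then show ?thesis by (simp add: gen_hom_def)
qed

lemma kernel_gen_hom:
  "kernel (presented_group I R) G (gen_hom G g) =
    {word_class I R w | w. w \<in> words I \<and> word_eval G g w = \<one>\<^bsub>G\<^esub>}"
  unfolding kernel_def carrier_presented_group using gen_hom_word_class by auto

lemma relations_hold_subgroup:
  assumes H: "subgroup H G" and g: "\<And>i. i \<in> I \<Longrightarrow> g i \<in> H"
  shows "relations_hold I R (G\<lparr>carrier := H\<rparr>) g"
proof -
  interpret H: group "G\<lparr>carrier := H\<rparr>" by (rule G.subgroup_imp_group[OF H])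
  show ?thesis
    using g G.word_eval_subgroup[OF H g] relator_trivial relators_in_words
    by unfold_locales auto
qed

lemma kernel_gen_hom_subgroup:
  assumes "subgroup H G" and "\<And>i. i \<in> I \<Longrightarrow> g i \<in> H"
  shows "kernel (presented_group I R) (G\<lparr>carrier := H\<rparr>) (gen_hom (G\<lparr>carrier := H\<rparr>) g) =
    kernel (presented_group I R) G (gen_hom G g)"
proof -
  interpret H: relations_hold I R "G\<lparr>carrier := H\<rparr>" g by (rule relations_hold_subgroup[OF assms])
  show ?thesis
    unfolding kernel_gen_hom H.kernel_gen_hom using G.word_eval_subgroup[OF assms] by auto
qed

end

lemma
  assumes "relations_hold I R G g" and "relations_hold I R H h"
  shows relations_hold_DirProd: "relations_hold I R (G \<times>\<times> H) (\<lambda>i. (g i, h i))"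
    and kernel_gen_hom_DirProd:
      "kernel (presented_group I R) (G \<times>\<times> H) (gen_hom (G \<times>\<times> H) (\<lambda>i. (g i, h i))) =
       kernel (presented_group I R) G (gen_hom G g) \<inter> kernel (presented_group I R) H (gen_hom H h)"
      (is ?kernel)
proof -
  interpret G: relations_hold I R G g by fact
  interpret H: relations_hold I R H h by fact
  interpret GH: group "G \<times>\<times> H" by (intro DirProd_group G.G.group_axioms H.G.group_axioms)
  have eval: "word_eval (G \<times>\<times> H) (\<lambda>i. (g i, h i)) w = (word_eval G g w, word_eval H h w)"
    if "w \<in> words I" for w
    using that G.gen_closed H.gen_closed
    by (intro word_eval_DirProd[where I = I]) (auto intro: G.G.group_axioms H.G.group_axioms)
  show "relations_hold I R (G \<times>\<times> H) (\<lambda>i. (g i, h i))"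
    using G.gen_closed H.gen_closed G.relator_trivial H.relator_trivial G.relators_in_words eval
    by unfold_locales auto
  then interpret GH: relations_hold I R "G \<times>\<times> H" "\<lambda>i. (g i, h i)" .
  show ?kernel
    unfolding kernel_def G.carrier_presented_group
    using eval by (auto simp: GH.gen_hom_word_class G.gen_hom_word_class H.gen_hom_word_class)
qed

lemma (in presentation) gen_hom_word_class_subst_word:
  assumes "presentation J S" and w: "w \<in> words J"
    and h: "\<And>j. j \<in> J \<Longrightarrow> h j \<in> words I" and g: "\<And>j. j \<in> J \<Longrightarrow> g j = word_class I R (h j)"
    and rel: "\<And>s. s \<in> S \<Longrightarrow> word_class I R (subst_word h s) = \<one>\<^bsub>presented_group I R\<^esub>"
  shows "gen_hom (presented_group I R) g (word_class J S w) = word_class I R (subst_word h w)"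
proof -
  interpret J: presentation J S by fact
  have eval: "word_eval (presented_group I R) g v = word_class I R (subst_word h v)"
    if v: "v \<in> words J" for v
  proof -
    have "word_eval (presented_group I R) g v =
        word_eval (presented_group I R) (\<lambda>j. word_class I R (h j)) v"
      using v g by (rule word_eval_cong)
    also have "\<dots> = word_class I R (subst_word h v)"
      using v h by (rule word_eval_word_class)
    finally show ?thesis .
  qed
  interpret relations_hold J S "presented_group I R" g
    using J.relators_in_words eval rel g h by unfold_locales (auto intro: word_class_closed)
  show ?thesis using w by (simp add: gen_hom_word_class eval)
qed

section \<open>The automorphisms of \<open>W\<^sup>+\<close>\<close>

declare One_nat_def [simp del]

definition run :: "nat \<Rightarrow> nat \<Rightarrow> word" where
  "run i j = map (\<lambda>k. (k, True)) [i..<Suc j]"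

definition bar_image :: "nat \<Rightarrow> word" where
  "bar_image i = (if i = 1 then [(1, False)]
     else if i = 2 then [(1, True), (1, True), (2, True)] else [(i, True)])"

abbreviation bar_word :: "word \<Rightarrow> word" where
  "bar_word \<equiv> subst_word bar_image"

abbreviation delta_word :: "nat \<Rightarrow> word \<Rightarrow> word" where
  "delta_word n \<equiv> subst_word (\<lambda>i. [(n - i, False)])"

abbreviation W_class :: "nat \<Rightarrow> word \<Rightarrow> word set" where
  "W_class n \<equiv> word_class {1..<n} (W_relators n)"

lemma W_relators_run: "W_relators n = {run i j @ run i j | i j. 1 \<le> i \<and> i < j \<and> j < n}"
  by (auto simp: W_relators_def run_def numeral_2_eq_2)

lemma run_in_words: "1 \<le> i \<Longrightarrow> j < n \<Longrightarrow> run i j \<in> words {1..<n}"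
  by (auto simp: run_def words_def)

lemma run_rec: "i \<le> j \<Longrightarrow> run i j = (i, True) # run (Suc i) j"
  by (simp add: run_def upt_rec)

lemma run_snoc: "i \<le> Suc j \<Longrightarrow> run i (Suc j) = run i j @ [(Suc j, True)]"
  by (simp add: run_def)

interpretation W: presentation "{1..<n}" "W_relators n"
  rewrites "presented_group {1..<n} (W_relators n) = W n" for n
proof -
  show "presentation {1..<n} (W_relators n)"
    using run_in_words by unfold_locales (auto simp: W_relators_run)
qed (simp add: W_def)

lemma W_class_run_square:
  assumes "1 \<le> i" and "i < j" and "j < n"
  shows "W_class n (run i j) \<otimes>\<^bsub>W n\<^esub> W_class n (run i j) = \<one>\<^bsub>W n\<^esub>"
proof -
  have "run i j @ run i j \<in> W_relators n" using assms by (auto simp: W_relators_run)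
  from W.word_class_relator[OF this] show ?thesis
    using assms by (simp add: W.word_class_mult run_in_words)
qed

lemma delta_word_in_words: "w \<in> words {1..<n} \<Longrightarrow> delta_word n w \<in> words {1..<n}"
  by (rule subst_word_in_words) auto

lemma delta_word_delta_word:
  assumes "w \<in> words {1..<n}"
  shows "delta_word n (delta_word n w) = w"
proof -
  have "delta_word n (delta_word n w) = subst_word (\<lambda>i. [(i, True)]) w"
    unfolding subst_word_subst_word using assms by (rule subst_word_cong) auto
  then show ?thesis by simp
qed

lemma delta_word_run:
  assumes "1 \<le> i" and "j < n"
  shows "delta_word n (run i j) = inv_word (run (n - j) (n - i))"
proof (cases "i \<le> j")
  case True
  from this assms(2) show ?thesis
  proof (induction rule: dec_induct)
    case base
    then show ?case by (simp add: run_def)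
  next
    case (step j)
    then have "run (n - Suc j) (n - i) = (n - Suc j, True) # run (n - j) (n - i)"
      using run_rec[of "n - Suc j" "n - i"] by (simp add: Suc_diff_Suc)
    with step show ?case by (simp add: run_snoc)
  qed
next
  case False
  with assms show ?thesis by (simp add: run_def)
qed

lemma W_delta_W_class:
  assumes "w \<in> words {1..<n}"
  shows "W_delta n (W_class n w) = W_class n (delta_word n w)"
  unfolding W_delta_def using W.presentation_axioms assms
proof (rule W.gen_hom_word_class_subst_word)
  fix i assume "i \<in> {1..<n}"
  then show "[(n - i, False)] \<in> words {1..<n}"
    and "inv\<^bsub>W n\<^esub> W_gen n (n - i) = W_class n [(n - i, False)]"
    using W.inv_word_class[of "[(n - i, True)]" n] by (auto simp: W_gen_def)
next
  fix r assume "r \<in> W_relators n"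
  then obtain i j where ij: "1 \<le> i" "i < j" "j < n" and r: "r = run i j @ run i j"
    by (auto simp: W_relators_run)
  let ?u = "run (n - j) (n - i)"
  have u: "?u \<in> words {1..<n}" using ij by (intro run_in_words) auto
  have "W_class n (delta_word n r) = inv\<^bsub>W n\<^esub> (W_class n ?u \<otimes>\<^bsub>W n\<^esub> W_class n ?u)"
    using u ij by (simp add: r delta_word_run W.word_class_mult W.inv_word_class)
  also have "\<dots> = \<one>\<^bsub>W n\<^esub>" using ij by (subst W_class_run_square) auto
  finally show "W_class n (delta_word n r) = \<one>\<^bsub>W n\<^esub>" .
qed

lemma bar_word_in_words: "w \<in> words {1..<n} \<Longrightarrow> bar_word w \<in> words {1..<n}"
  by (rule subst_word_in_words) (auto simp: bar_image_def split: if_splits)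

lemma W_class_bar_word_bar_word:
  assumes "w \<in> words {1..<n}"
  shows "W_class n (bar_word (bar_word w)) = W_class n w"
proof -
  have "W_class n (bar_word (bar_word w)) = W_class n (subst_word (\<lambda>i. [(i, True)]) w)"
    unfolding subst_word_subst_word using assms
  proof (rule W.word_class_subst_word_cong)
    fix i assume i: "i \<in> {1..<n}"
    show "bar_word (bar_image i) \<in> words {1..<n}"
      using i by (intro bar_word_in_words) (auto simp: bar_image_def)
    have "W_class n [(1, False), (1, False), (1, True), (1, True), (2, True)] = W_class n [(2, True)]"
      if "i = 2"
      using i that W.word_class_cancel[of "[(1, False)]" n "[(1, True), (2, True)]" 1 False]
        W.word_class_cancel[of "[]" n "[(2, True)]" 1 False] by simp
    then show "W_class n (bar_word (bar_image i)) = W_class n [(i, True)]"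
      by (simp add: bar_image_def)
  qed auto
  then show ?thesis by simp
qed

lemma (in group) mult_involution_square:
  assumes x: "x \<in> carrier G" and y: "y \<in> carrier G" and yy: "y \<otimes> y = \<one>"
    and "(inv x \<otimes> y) \<otimes> (inv x \<otimes> y) = \<one>"
  shows "(x \<otimes> y) \<otimes> (x \<otimes> y) = \<one>"
proof -
  have "inv x \<otimes> (y \<otimes> inv x \<otimes> y) = \<one>" using assms by (simp add: m_assoc)
  then have "y \<otimes> inv x \<otimes> y = x" using x y by (simp add: inv_solve_left')
  moreover have "y \<otimes> (y \<otimes> inv x \<otimes> y) \<otimes> y = (y \<otimes> y) \<otimes> inv x \<otimes> (y \<otimes> y)"
    using x y by (simp add: m_assoc)
  ultimately have "y \<otimes> x \<otimes> y = inv x" using x yy by simp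
  then show ?thesis using x y by (simp add: m_assoc)
qed

lemma bar_word_run:
  assumes "3 \<le> i"
  shows "bar_word (run i j) = run i j"
proof -
  have "run i j \<in> words {3..}" using assms by (auto simp: run_def words_def)
  then have "bar_word (run i j) = subst_word (\<lambda>k. [(k, True)]) (run i j)"
    by (rule subst_word_cong) (auto simp: bar_image_def)
  then show ?thesis by simp
qed

lemma bar_word_run_2:
  assumes "2 \<le> j"
  shows "bar_word (run 2 j) = (1, True) # run 1 j"
  using assms by (simp add: run_rec bar_word_run bar_image_def numeral_2_eq_2 numeral_3_eq_3)

lemma bar_word_run_1:
  assumes "2 \<le> j"
  shows "bar_word (run 1 j) = (1, False) # (1, True) # run 1 j"
  using assms bar_word_run_2[OF assms]
  by (simp add: run_rec[of 1] bar_image_def numeral_2_eq_2)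

lemma W_class_bar_word_run_square:
  assumes "1 \<le> i" and "i < j" and "j < n"
  shows "W_class n (bar_word (run i j)) \<otimes>\<^bsub>W n\<^esub> W_class n (bar_word (run i j)) = \<one>\<^bsub>W n\<^esub>"
proof -
  let ?s = "W_class n [(1, True)]" and ?t = "W_class n (run 1 j)"
  have letters: "[(1, b)] \<in> words {1..<n}" "run 1 j \<in> words {1..<n}" "run 2 j \<in> words {1..<n}" for b
    using assms by (auto intro!: run_in_words)
  consider "i = 1" | "i = 2" | "3 \<le> i" using assms by linarith
  then show ?thesis
  proof cases
    case 1
    then have "W_class n (bar_word (run i j)) = ?t"
      using assms letters W.word_class_cancel[of "[]" n "run 1 j" 1 False]
      by (simp add: bar_word_run_1)
    then show ?thesis using assms by (simp add: W_class_run_square)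
  next
    case 2
    have quotient: "inv\<^bsub>W n\<^esub> ?s \<otimes>\<^bsub>W n\<^esub> ?t = W_class n (run 2 j)"
      using assms letters W.word_class_cancel[of "[]" n "run 2 j" 1 False] run_rec[of 1 j]
      by (simp add: W.inv_word_class W.word_class_mult numeral_2_eq_2)
    have "(?s \<otimes>\<^bsub>W n\<^esub> ?t) \<otimes>\<^bsub>W n\<^esub> (?s \<otimes>\<^bsub>W n\<^esub> ?t) = \<one>\<^bsub>W n\<^esub>"
      by (rule W.mult_involution_square)
        (use assms 2 letters quotient in \<open>simp_all add: W.word_class_closed W_class_run_square\<close>)
    moreover have "W_class n (bar_word (run i j)) = ?s \<otimes>\<^bsub>W n\<^esub> ?t"
      using assms 2 letters by (simp add: bar_word_run_2 W.word_class_mult)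
    ultimately show ?thesis by simp
  next
    case 3
    then show ?thesis using assms by (simp add: bar_word_run W_class_run_square)
  qed
qed

lemma W_bar_W_class:
  assumes "w \<in> words {1..<n}"
  shows "W_bar n (W_class n w) = W_class n (bar_word w)"
  unfolding W_bar_def using W.presentation_axioms assms
proof (rule W.gen_hom_word_class_subst_word)
  fix i assume i: "i \<in> {1..<n}"
  then show "bar_image i \<in> words {1..<n}" by (auto simp: bar_image_def)
  have "W_gen n 1 [^]\<^bsub>W n\<^esub> (2::nat) = W_class n [(1, True), (1, True)]"
    using i by (simp add: W_gen_def numeral_2_eq_2 W.word_class_mult W.word_class_closed)
  then show "(if i = 1 then inv\<^bsub>W n\<^esub> (W_gen n 1)
      else if i = 2 then W_gen n 1 [^]\<^bsub>W n\<^esub> (2::nat) \<otimes>\<^bsub>W n\<^esub> W_gen n 2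
      else W_gen n i) = W_class n (bar_image i)"
    using i by (auto simp: bar_image_def W_gen_def W.inv_word_class W.word_class_mult)
next
  fix r assume "r \<in> W_relators n"
  then obtain i j where ij: "1 \<le> i" "i < j" "j < n" and r: "r = run i j @ run i j"
    by (auto simp: W_relators_run)
  then have "bar_word (run i j) \<in> words {1..<n}" by (intro bar_word_in_words run_in_words)
  then show "W_class n (bar_word r) = \<one>\<^bsub>W n\<^esub>"
    using W_class_bar_word_run_square[OF ij] by (simp add: r W.word_class_mult)
qed

lemma
  assumes "c \<in> carrier (W n)"
  shows W_delta_closed: "W_delta n c \<in> carrier (W n)"
    and W_delta_W_delta: "W_delta n (W_delta n c) = c"
    and W_bar_W_bar: "W_bar n (W_bar n c) = c"
  using assms
  by (auto simp: W.carrier_presented_group W_delta_W_class delta_word_in_words delta_word_delta_word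
      W_bar_W_class bar_word_in_words W_class_bar_word_bar_word)

lemma struct_dual_subset: "N \<subseteq> carrier (W n) \<Longrightarrow> struct_dual n N \<subseteq> carrier (W n)"
  by (auto simp: struct_dual_def W_delta_closed)

lemma struct_dual_struct_dual:
  assumes "N \<subseteq> carrier (W n)"
  shows "struct_dual n (struct_dual n N) = N"
proof -
  have "W_delta n (W_delta n c) = c" if "c \<in> N" for c
    using that assms W_delta_W_delta by blast
  then show ?thesis by (simp add: struct_dual_def image_image)
qed

lemma struct_mirror_struct_mirror:
  assumes "N \<subseteq> carrier (W n)"
  shows "struct_mirror n (struct_mirror n N) = N"
proof -
  have "W_bar n (W_bar n c) = c" if "c \<in> N" for c
    using that assms W_bar_W_bar by blast
  then show ?thesis by (simp add: struct_mirror_def image_image)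
qed

lemma struct_dual_Int:
  assumes "M \<subseteq> carrier (W n)" and "N \<subseteq> carrier (W n)"
  shows "struct_dual n (M \<inter> N) = struct_dual n M \<inter> struct_dual n N"
  unfolding struct_dual_def
  using assms
  by (intro inj_on_image_Int[of _ "carrier (W n)"] inj_on_inverseI[where g = "W_delta n"] W_delta_W_delta)

lemma struct_mirror_Int:
  assumes "M \<subseteq> carrier (W n)" and "N \<subseteq> carrier (W n)"
  shows "struct_mirror n (M \<inter> N) = struct_mirror n M \<inter> struct_mirror n N"
  unfolding struct_mirror_def
  using assms
  by (intro inj_on_image_Int[of _ "carrier (W n)"] inj_on_inverseI[where g = "W_bar n"] W_bar_W_bar)

section \<open>Words acting on flags\<close>

fun word_act :: "(nat \<Rightarrow> 'x \<Rightarrow> 'x) \<Rightarrow> word \<Rightarrow> 'x \<Rightarrow> 'x" where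
  "word_act a [] x = x"
| "word_act a ((i, b) # w) x =
     (if b then a (i - 1) (a i (word_act a w x)) else a i (a (i - 1) (word_act a w x)))"

lemma word_act_append: "word_act a (u @ v) x = word_act a u (word_act a v x)"
  by (induction u) auto

locale string_coxeter_action =
  fixes X :: "'x set" and n :: nat and a :: "nat \<Rightarrow> 'x \<Rightarrow> 'x"
  assumes closed: "x \<in> X \<Longrightarrow> j < n \<Longrightarrow> a j x \<in> X"
    and involution: "x \<in> X \<Longrightarrow> j < n \<Longrightarrow> a j (a j x) = x"
    and commute: "x \<in> X \<Longrightarrow> i + 1 < j \<Longrightarrow> j < n \<Longrightarrow> a i (a j x) = a j (a i x)"
begin

lemma word_act_closed: "w \<in> words {1..<n} \<Longrightarrow> x \<in> X \<Longrightarrow> word_act a w x \<in> X"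
  by (induction w) (auto intro!: closed)

lemma word_act_inv_word:
  "w \<in> words {1..<n} \<Longrightarrow> x \<in> X \<Longrightarrow> word_act a (inv_word w) (word_act a w x) = x"
  by (induction w) (auto simp: word_act_append closed involution word_act_closed)

lemma word_act_run:
  assumes "1 \<le> i" and "i \<le> j" and "j < n" and "x \<in> X"
  shows "word_act a (run i j) x = a (i - 1) (a j x)"
  using assms(2,1,3,4)
proof (induction rule: inc_induct)
  case base
  then show ?case by (simp add: run_def)
next
  case (step i)
  then show ?case by (simp add: run_rec involution closed)
qed

lemma word_act_relator:
  assumes "r \<in> W_relators n" and "x \<in> X"
  shows "word_act a r x = x"
proof -
  from assms obtain i j where ij: "1 \<le> i" "i < j" "j < n" and r: "r = run i j @ run i j"
    by (auto simp: W_relators_run)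
  then show ?thesis
    using commute[of x "i - 1" j] assms(2)
    by (simp add: word_act_append word_act_run closed involution)
qed

end

lemma word_act_subst_word:
  assumes "string_coxeter_action X n a" and "string_coxeter_action Y m b"
    and f: "f \<in> X \<rightarrow> Y" and h: "\<And>i. i \<in> {1..<n} \<Longrightarrow> h i \<in> words {1..<m}"
    and letter: "\<And>i x. i \<in> {1..<n} \<Longrightarrow> x \<in> X \<Longrightarrow> word_act b (h i) (f x) = f (a (i - 1) (a i x))"
    and "w \<in> words {1..<n}" and x: "x \<in> X"
  shows "word_act b (subst_word h w) (f x) = f (word_act a w x)"
  using assms(6)
proof (induction w)
  case (Cons l w)
  interpret a: string_coxeter_action X n a by fact
  interpret b: string_coxeter_action Y m b by fact
  obtain i c where l: "l = (i, c)" by force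
  have i: "i \<in> {1..<n}" "i < n" "i - 1 < n" and w: "w \<in> words {1..<n}" using Cons.prems l by auto
  let ?y = "word_act a w x" and ?z = "a i (a (i - 1) (word_act a w x))"
  have y: "?y \<in> X" using a.word_act_closed[OF w x] .
  then have z: "?z \<in> X" using i by (simp add: a.closed)
  have "word_act b (h i) (f ?z) = f ?y"
    using letter[OF i(1) z] y i by (simp add: a.closed a.involution)
  then have "word_act b (inv_word (h i)) (f ?y) = f ?z"
    using b.word_act_inv_word[OF h[OF i(1)], of "f ?z"] f z by auto
  then show ?case
    using Cons.IH[OF w] letter[OF i(1) y] by (simp add: l word_act_append)
qed simp

lemma word_act_delta_word:
  assumes "string_coxeter_action X n a" and "string_coxeter_action X n b"
    and rev: "\<And>j. j < n \<Longrightarrow> b j = a (n - 1 - j)" and "w \<in> words {1..<n}" and "x \<in> X"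
  shows "word_act a (delta_word n w) x = word_act b w x"
proof -
  have letter: "b (i - 1) = a (n - i)" "b i = a (n - i - 1)" if "i \<in> {1..<n}" for i
    using that rev[of "i - 1"] rev[of i] by (auto simp: less_imp_diff_less add.commute)
  have "word_act a (delta_word n w) (id x) = id (word_act b w x)"
    by (rule word_act_subst_word[OF assms(2,1) _ _ _ assms(4,5)]) (auto simp: letter)
  then show ?thesis by simp
qed

lemma (in string_coxeter_action) word_act_bar_word:
  assumes n: "0 < n" and "w \<in> words {1..<n}" and "x \<in> X"
  shows "word_act a (bar_word w) (a 0 x) = a 0 (word_act a w x)"
  using string_coxeter_action_axioms string_coxeter_action_axioms _ _ _ assms(2,3)
proof (rule word_act_subst_word)
  fix i x assume i: "i \<in> {1..<n}" and x: "x \<in> X"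
  consider "i = 1" | "i = 2" | "3 \<le> i" using i by force
  then show "word_act a (bar_image i) (a 0 x) = a 0 (a (i - 1) (a i x))"
  proof cases
    case 1
    then show ?thesis using i x by (simp add: bar_image_def closed involution)
  next
    case 2
    then have "a 2 (a 0 x) = a 0 (a 2 x)" using i x commute[of x 0 2] by simp
    then show ?thesis using 2 i x by (simp add: bar_image_def closed involution One_nat_def)
  next
    case 3
    then show ?thesis
      using i x commute[of x 0 i] commute[of "a i x" 0 "i - 1"] by (simp add: bar_image_def closed)
  qed
qed (use n in \<open>auto simp: closed bar_image_def\<close>)

section \<open>Flags of a polytope\<close>

definition differing_ranks :: "'a based_poset \<Rightarrow> 'a set \<Rightarrow> 'a set \<Rightarrow> int set" where
  "differing_ranks P A B = rk P ` (A - B)"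

lemma differing_ranks_triangle:
  "differing_ranks P A C \<subseteq> differing_ranks P A B \<union> differing_ranks P B C"
  by (auto simp: differing_ranks_def)

lemma mem_if_rk_notin_differing_ranks:
  "F \<in> A \<Longrightarrow> rk P F \<notin> differing_ranks P A B \<Longrightarrow> F \<in> B"
  by (auto simp: differing_ranks_def)

locale abstract_polytope =
  fixes n :: nat and P :: "'a based_poset"
  assumes polytope: "polytope n P"
begin

lemma partial_order: "Partial_order (face_le P)"
  and rk_bounds: "F \<in> faces P \<Longrightarrow> rk P F \<in> {-1..int n}"
  and rk_strict_mono: "face_less P F G \<Longrightarrow> rk P F < rk P G"
  and card_flag: "\<Psi> \<in> flags P \<Longrightarrow> card \<Psi> = n + 2"
  and diamond: "face_less P F G \<Longrightarrow> rk P G = rk P F + 2 \<Longrightarrow>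
        card {H. rk P H = rk P F + 1 \<and> face_less P F H \<and> face_less P H G} = 2"
  and flag_connected: "strongly_flag_connected P"
  and base_flag: "base P \<in> flags P"
  using polytope by (auto simp: polytope_def)

lemma face_le_refl: "F \<in> faces P \<Longrightarrow> (F, F) \<in> face_le P"
  and face_le_trans: "(F, G) \<in> face_le P \<Longrightarrow> (G, H) \<in> face_le P \<Longrightarrow> (F, H) \<in> face_le P"
  and face_le_faces: "(F, G) \<in> face_le P \<Longrightarrow> F \<in> faces P \<and> G \<in> faces P"
  using partial_order
  by (auto simp: partial_order_on_def preorder_on_def refl_on_def faces_def Field_def dest: transD)

lemma chain_faces: "C \<in> Chains (face_le P) \<Longrightarrow> C \<subseteq> faces P"
  using face_le_faces by (auto simp: Chains_def)

lemma chain_less: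
  assumes "C \<in> Chains (face_le P)" and "F \<in> C" and "G \<in> C" and "rk P F < rk P G"
  shows "face_less P F G"
  using assms rk_strict_mono[of G F] by (fastforce simp: Chains_def face_less_def)

lemma inj_on_rk_chain: "C \<in> Chains (face_le P) \<Longrightarrow> inj_on (rk P) C"
  using rk_strict_mono by (fastforce simp: Chains_def inj_on_def face_less_def)

lemma
  assumes "C \<in> Chains (face_le P)"
  shows finite_chain: "finite C" and card_chain_le: "card C \<le> n + 2"
proof -
  have ranks: "rk P ` C \<subseteq> {-1..int n}" using chain_faces[OF assms] rk_bounds by blast
  show "finite C"
    using ranks inj_on_rk_chain[OF assms]
    by (metis finite_atLeastAtMost_int finite_imageD finite_subset)
  show "card C \<le> n + 2"
    using card_mono[OF _ ranks] card_image[OF inj_on_rk_chain[OF assms]] by simp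
qed

lemma flag_chain: "\<Psi> \<in> flags P \<Longrightarrow> \<Psi> \<in> Chains (face_le P)"
  by (simp add: flags_def)

lemma flag_faces: "\<Psi> \<in> flags P \<Longrightarrow> \<Psi> \<subseteq> faces P"
  using flag_chain chain_faces by blast

lemma flagI:
  assumes "C \<in> Chains (face_le P)" and "card C = n + 2"
  shows "C \<in> flags P"
proof -
  have "C = D" if "D \<in> Chains (face_le P)" "C \<subseteq> D" for D
    using finite_chain[OF that(1)] card_chain_le[OF that(1)] assms(2) that(2)
    by (intro card_seteq) auto
  then show ?thesis using assms(1) by (simp add: flags_def)
qed

lemma face_in_flag:
  assumes "F \<in> faces P"
  obtains \<Psi> where "\<Psi> \<in> flags P" and "F \<in> \<Psi>"
proof -
  let ?chain = "\<lambda>D. D \<in> Chains (face_le P) \<and> F \<in> D"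
  have "?chain {F}" using face_le_refl[OF assms] by (simp add: Chains_def)
  moreover have "\<forall>D. ?chain D \<longrightarrow> card D < n + 3" using card_chain_le by fastforce
  ultimately obtain D where D: "?chain D" and max: "\<And>E. ?chain E \<Longrightarrow> card E \<le> card D"
    using ex_has_greatest_nat[of ?chain _ card] by blast
  have "D = E" if "E \<in> Chains (face_le P)" "D \<subseteq> E" for E
    using that max[of E] D finite_chain[of E] by (intro card_seteq) auto
  with D that show ?thesis by (auto simp: flags_def)
qed

lemma flag_face_eqI:
  "\<Psi> \<in> flags P \<Longrightarrow> F \<in> \<Psi> \<Longrightarrow> G \<in> \<Psi> \<Longrightarrow> rk P F = rk P G \<Longrightarrow> F = G"
  using inj_on_rk_chain[OF flag_chain] by (auto dest: inj_onD)

lemma rk_image_flag: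
  assumes "\<Psi> \<in> flags P"
  shows "rk P ` \<Psi> = {-1..int n}"
proof (rule card_subset_eq)
  show "rk P ` \<Psi> \<subseteq> {-1..int n}" using flag_faces[OF assms] rk_bounds by blast
  show "card (rk P ` \<Psi>) = card {-1..int n}"
    using card_image[OF inj_on_rk_chain[OF flag_chain[OF assms]]] card_flag[OF assms] by simp
qed simp

lemma ex_flag_face:
  assumes "\<Psi> \<in> flags P" and "-1 \<le> r" and "r \<le> int n"
  obtains F where "F \<in> \<Psi>" and "rk P F = r"
  using rk_image_flag[OF assms(1)] assms(2,3) by (metis atLeastAtMost_iff imageE)

lemma differing_ranks_flags:
  assumes "A \<in> flags P" and "B \<in> flags P"
  shows "differing_ranks P A B = {-1..int n} - rk P ` (A \<inter> B)"
proof -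
  have "rk P ` (A - A \<inter> B) = rk P ` A - rk P ` (A \<inter> B)"
    using inj_on_rk_chain[OF flag_chain[OF assms(1)]] by (rule inj_on_image_set_diff) auto
  then show ?thesis by (simp add: differing_ranks_def rk_image_flag[OF assms(1)] Diff_Int)
qed

lemma differing_ranks_commute:
  "A \<in> flags P \<Longrightarrow> B \<in> flags P \<Longrightarrow> differing_ranks P A B = differing_ranks P B A"
  by (simp add: differing_ranks_flags Int_commute)

lemma differing_ranks_eq_empty_iff:
  assumes "A \<in> flags P" and "B \<in> flags P"
  shows "differing_ranks P A B = {} \<longleftrightarrow> A = B"
  using differing_ranks_commute[OF assms] by (auto simp: differing_ranks_def)

lemma off_rank_eq_iff:
  assumes "A \<in> flags P" and "B \<in> flags P"
  shows "{F \<in> A. rk P F \<noteq> s} = {F \<in> B. rk P F \<noteq> s} \<longleftrightarrow> differing_ranks P A B \<subseteq> {s}"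
proof
  assume "differing_ranks P A B \<subseteq> {s}"
  moreover from this have "differing_ranks P B A \<subseteq> {s}"
    using differing_ranks_commute[OF assms] by simp
  ultimately show "{F \<in> A. rk P F \<noteq> s} = {F \<in> B. rk P F \<noteq> s}"
    by (auto simp: differing_ranks_def)
qed (auto simp: differing_ranks_def)

lemma comparable_face_in_flag:
  assumes F: "F \<in> faces P" and cmp: "\<forall>G \<in> faces P. (F, G) \<in> face_le P \<or> (G, F) \<in> face_le P"
    and \<Psi>: "\<Psi> \<in> flags P"
  shows "F \<in> \<Psi>"
proof -
  have "insert F \<Psi> \<in> Chains (face_le P)"
    using cmp flag_chain[OF \<Psi>] flag_faces[OF \<Psi>] face_le_refl[OF F] by (auto simp: Chains_def)
  then show ?thesis using \<Psi> by (auto simp: flags_def)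
qed

lemma differing_ranks_interior:
  assumes "A \<in> flags P" and "B \<in> flags P"
  shows "differing_ranks P A B \<subseteq> {0..<int n}"
proof -
  obtain L where L: "L \<in> faces P" "rk P L = -1" "\<forall>G \<in> faces P. (L, G) \<in> face_le P"
    using polytope unfolding polytope_def by blast
  obtain U where U: "U \<in> faces P" "rk P U = int n" "\<forall>G \<in> faces P. (G, U) \<in> face_le P"
    using polytope unfolding polytope_def by blast
  have "L \<in> A \<inter> B" "U \<in> A \<inter> B"
    using assms L U by (auto intro: comparable_face_in_flag)
  then have "-1 \<in> rk P ` (A \<inter> B)" "int n \<in> rk P ` (A \<inter> B)"
    using L U by (metis image_eqI)+
  then have "-1 \<notin> differing_ranks P A B" "int n \<notin> differing_ranks P A B"
    and "differing_ranks P A B \<subseteq> {-1..int n}"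
    using differing_ranks_flags[OF assms] by auto
  moreover have "{-1..int n} - {-1, int n} \<subseteq> {0..<int n}" by auto
  ultimately show ?thesis by blast
qed

lemma adjacent_iff_card_differing_ranks:
  assumes "A \<in> flags P" and "B \<in> flags P"
  shows "adjacent A B \<longleftrightarrow> card (differing_ranks P A B) = 1"
proof -
  have card: "card (differing_ranks P C D) = card (C - D)" if "C \<in> flags P" for C D
    unfolding differing_ranks_def
    using inj_on_subset[OF inj_on_rk_chain[OF flag_chain[OF that]]] by (intro card_image) auto
  then show ?thesis
    using assms card[of A B] card[of B A] differing_ranks_commute[OF assms]
    by (simp add: adjacent_def)
qed

text \<open>The \<open>j\<close>-faces of the three flags lie in one diamond, which has only two of them.\<close>

lemma diamond_differing_ranks:
  assumes A: "A \<in> flags P" and B: "B \<in> flags P" and C: "C \<in> flags P"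
    and differ: "j \<in> differing_ranks P C A" "j \<in> differing_ranks P C B"
    and agree: "{j - 1, j + 1} \<inter> (differing_ranks P C A \<union> differing_ranks P C B) = {}"
  shows "j \<notin> differing_ranks P A B"
proof
  assume "j \<in> differing_ranks P A B"
  then obtain K where K: "K \<in> A" "K \<notin> B" "rk P K = j" by (auto simp: differing_ranks_def)
  have j: "0 \<le> j" "j < int n" using differing_ranks_interior[OF C A] differ by auto
  obtain F where F: "F \<in> C" "rk P F = j - 1" using ex_flag_face[OF C, of "j - 1"] j by auto
  obtain G where G: "G \<in> C" "rk P G = j + 1" using ex_flag_face[OF C, of "j + 1"] j by auto
  obtain H where H: "H \<in> C" "H \<notin> A" "rk P H = j" using differ by (auto simp: differing_ranks_def)
  obtain M where M: "M \<in> B" "rk P M = j" using ex_flag_face[OF B, of j] j by auto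
  have "H \<notin> B"
    using differ(2) H(1,3) flag_face_eqI[OF C] by (auto simp: differing_ranks_def)
  then have distinct: "K \<noteq> H" "K \<noteq> M" "H \<noteq> M" using K H M by auto
  let ?S = "{N. rk P N = rk P F + 1 \<and> face_less P F N \<and> face_less P N G}"
  have between: "N \<in> ?S" if "D \<in> flags P" "F \<in> D" "G \<in> D" "N \<in> D" "rk P N = j" for D N
    using chain_less[OF flag_chain[OF that(1)]] that F G by auto
  have common: "N \<in> A" "N \<in> B" if "N \<in> C" "rk P N \<in> {j - 1, j + 1}" for N
    by (rule mem_if_rk_notin_differing_ranks[of N C P]; use that agree in blast)+
  have "F \<in> A" "G \<in> A" "F \<in> B" "G \<in> B" using common F G by auto
  then have "{K, H, M} \<subseteq> ?S"
    using between[OF A _ _ K(1,3)] between[OF B _ _ M] between[OF C F(1) G(1) H(1,3)] by blast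
  moreover have card: "card ?S = 2"
    using chain_less[OF flag_chain[OF C]] F G by (intro diamond) auto
  moreover have "finite ?S" by (rule card_ge_0_finite) (simp add: card)
  ultimately have "card {K, H, M} \<le> 2" using card_mono[of ?S "{K, H, M}"] by simp
  then show False using distinct by simp
qed

lemma replace_face_flag:
  assumes \<Psi>: "\<Psi> \<in> flags P" and F: "F \<in> \<Psi>" and G: "G \<in> \<Psi>" and H: "H \<in> \<Psi>"
    and rk: "rk P H = rk P F + 1" "rk P G = rk P H + 1"
    and K: "rk P K = rk P H" "K \<noteq> H" "face_less P F K" "face_less P K G"
  shows "insert K (\<Psi> - {H}) \<in> flags P"
proof (rule flagI)
  have le: "(F, K) \<in> face_le P" "(K, G) \<in> face_le P" using K by (auto simp: face_less_def)
  have comparable: "(L, K) \<in> face_le P \<or> (K, L) \<in> face_le P" if L: "L \<in> \<Psi>" "L \<noteq> H" for L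
  proof -
    have "rk P L \<noteq> rk P H" using flag_face_eqI[OF \<Psi> L(1) H] L(2) by blast
    then consider "rk P L < rk P F" | "L = F" | "L = G" | "rk P G < rk P L"
      using rk flag_face_eqI[OF \<Psi> L(1) F] flag_face_eqI[OF \<Psi> L(1) G] by linarith
    then show ?thesis
    proof cases
      case 1
      then have "(L, F) \<in> face_le P"
        using chain_less[OF flag_chain[OF \<Psi>] L(1) F] by (simp add: face_less_def)
      then show ?thesis using le face_le_trans by blast
    next
      case 4
      then have "(G, L) \<in> face_le P"
        using chain_less[OF flag_chain[OF \<Psi>] G L(1)] by (simp add: face_less_def)
      then show ?thesis using le face_le_trans by blast
    qed (use le in auto)
  qed
  have "(K, K) \<in> face_le P" using le face_le_faces face_le_refl by blast
  then show "insert K (\<Psi> - {H}) \<in> Chains (face_le P)"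
    using comparable flag_chain[OF \<Psi>] by (auto simp: Chains_def)
  have "K \<notin> \<Psi>" using flag_face_eqI[OF \<Psi> _ H] K by blast
  then show "card (insert K (\<Psi> - {H})) = n + 2"
    using card_flag[OF \<Psi>] H finite_chain[OF flag_chain[OF \<Psi>]] by simp
qed

lemma ex_adjacent_flag:
  assumes \<Psi>: "\<Psi> \<in> flags P" and j: "j < n"
  obtains \<Psi>' where "\<Psi>' \<in> flags P" and "differing_ranks P \<Psi>' \<Psi> = {int j}"
proof -
  obtain F where F: "F \<in> \<Psi>" "rk P F = int j - 1" using ex_flag_face[OF \<Psi>, of "int j - 1"] j by auto
  obtain G where G: "G \<in> \<Psi>" "rk P G = int j + 1" using ex_flag_face[OF \<Psi>, of "int j + 1"] j by auto
  obtain H where H: "H \<in> \<Psi>" "rk P H = int j" using ex_flag_face[OF \<Psi>, of "int j"] j by auto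
  have "card {K. rk P K = rk P F + 1 \<and> face_less P F K \<and> face_less P K G} = 2"
    using chain_less[OF flag_chain[OF \<Psi>]] F G by (intro diamond) auto
  then obtain K where K: "rk P K = int j" "K \<noteq> H" "face_less P F K" "face_less P K G"
    using F by (auto simp: card_2_iff set_eq_iff)
  have "insert K (\<Psi> - {H}) - \<Psi> = {K}" using flag_face_eqI[OF \<Psi> _ H(1)] K(1,2) H(2) by auto
  then show ?thesis
    using replace_face_flag[OF \<Psi> F(1) G(1) H(1)] F G H K
    by (intro that[of "insert K (\<Psi> - {H})"]) (auto simp: differing_ranks_def)
qed

lemma flag_adj_eqI:
  assumes \<Psi>: "\<Psi> \<in> flags P" and A: "A \<in> flags P" and ranks: "differing_ranks P A \<Psi> = {int j}"
  shows "flag_adj P j \<Psi> = A"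
  unfolding flag_adj_def
proof (rule the_equality)
  show "A \<in> flags P \<and> A \<noteq> \<Psi> \<and> {F \<in> A. rk P F \<noteq> int j} = {F \<in> \<Psi>. rk P F \<noteq> int j}"
    using A \<Psi> ranks differing_ranks_eq_empty_iff[OF A \<Psi>] by (simp add: off_rank_eq_iff)
next
  fix B assume "B \<in> flags P \<and> B \<noteq> \<Psi> \<and> {F \<in> B. rk P F \<noteq> int j} = {F \<in> \<Psi>. rk P F \<noteq> int j}"
  then have B: "B \<in> flags P" and "differing_ranks P B \<Psi> = {int j}"
    using differing_ranks_eq_empty_iff[OF _ \<Psi>, of B] \<Psi> off_rank_eq_iff[of B \<Psi> "int j"] by auto
  then have eq: "differing_ranks P \<Psi> A = {int j}" "differing_ranks P \<Psi> B = {int j}"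
    using ranks differing_ranks_commute \<Psi> A B by simp_all
  then have "int j \<notin> differing_ranks P B A"
    by (intro diamond_differing_ranks[OF B A \<Psi>]) auto
  moreover have "differing_ranks P B A \<subseteq> {int j}"
    using differing_ranks_triangle[of P B A \<Psi>] eq differing_ranks_commute[OF \<Psi> B] by auto
  ultimately show "B = A" using differing_ranks_eq_empty_iff[OF B A] by auto
qed

lemma
  assumes \<Psi>: "\<Psi> \<in> flags P" and j: "j < n"
  shows flag_adj_flag: "flag_adj P j \<Psi> \<in> flags P"
    and differing_ranks_flag_adj: "differing_ranks P (flag_adj P j \<Psi>) \<Psi> = {int j}"
  using ex_adjacent_flag[OF assms] flag_adj_eqI[OF \<Psi>] by metis+

lemma flag_adj_flag_adj:
  assumes "\<Psi> \<in> flags P" and "j < n"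
  shows "flag_adj P j (flag_adj P j \<Psi>) = \<Psi>"
  using assms differing_ranks_flag_adj[OF assms] differing_ranks_commute[OF flag_adj_flag[OF assms]]
  by (intro flag_adj_eqI flag_adj_flag) auto

lemma flag_adj_commute:
  assumes \<Psi>: "\<Psi> \<in> flags P" and ij: "i + 1 < j" and j: "j < n"
  shows "flag_adj P i (flag_adj P j \<Psi>) = flag_adj P j (flag_adj P i \<Psi>)"
proof -
  have i: "i < n" using ij j by simp
  define A where "A = flag_adj P j \<Psi>"
  define B where "B = flag_adj P i A"
  define C where "C = flag_adj P j B"
  have flags: "A \<in> flags P" "B \<in> flags P" "C \<in> flags P"
    using \<Psi> i j by (auto simp: A_def B_def C_def intro!: flag_adj_flag)
  let ?D = "differing_ranks P"
  have sym: "?D X Y = ?D Y X" if "X \<in> {A, B, C, \<Psi>}" "Y \<in> {A, B, C, \<Psi>}" for X Y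
    by (rule differing_ranks_commute) (use that flags \<Psi> in auto)
  have D: "?D A \<Psi> = {int j}" "?D B A = {int i}" "?D C B = {int j}"
    using differing_ranks_flag_adj flags \<Psi> i j by (auto simp: A_def B_def C_def)
  have B\<Psi>: "?D B \<Psi> \<subseteq> {int i, int j}" "int j \<in> ?D B \<Psi>"
    using differing_ranks_triangle[of P B \<Psi> A] differing_ranks_triangle[of P A \<Psi> B]
      sym[of A B] D ij by auto
  have "int j \<notin> ?D C \<Psi>"
    using B\<Psi> sym[of B C] D ij by (intro diamond_differing_ranks[OF flags(3) \<Psi> flags(2)]) auto
  moreover have "?D C \<Psi> \<subseteq> {int i, int j}"
    using differing_ranks_triangle[of P C \<Psi> B] B\<Psi> D by auto
  moreover have "int i \<in> ?D C \<Psi>"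
    using differing_ranks_triangle[of P B A C] differing_ranks_triangle[of P C A \<Psi>]
      sym[of B C] sym[of \<Psi> A] D ij by auto
  ultimately have "?D C \<Psi> = {int i}" by auto
  then have "flag_adj P i \<Psi> = C" using \<Psi> flags by (intro flag_adj_eqI)
  then show ?thesis
    using flag_adj_flag_adj[OF flags(2) j] by (simp add: A_def B_def C_def)
qed

sublocale string_coxeter_action "flags P" n "flag_adj P"
  by unfold_locales (rule flag_adj_flag flag_adj_flag_adj flag_adj_commute; assumption)+

lemma adjacent_iff_flag_adj:
  assumes A: "A \<in> flags P" and B: "B \<in> flags P"
  shows "adjacent A B \<longleftrightarrow> (\<exists>j < n. B = flag_adj P j A)"
proof
  assume "adjacent A B"
  then obtain r where r: "differing_ranks P A B = {r}"
    unfolding adjacent_iff_card_differing_ranks[OF assms] by (rule card_1_singletonE)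
  then obtain j where "r = int j" "j < n"
    using differing_ranks_interior[OF assms] by (auto elim: nonneg_int_cases)
  then show "\<exists>j < n. B = flag_adj P j A"
    using flag_adj_eqI[OF A B] r differing_ranks_commute[OF assms] by auto
next
  assume "\<exists>j < n. B = flag_adj P j A"
  then show "adjacent A B"
    using differing_ranks_flag_adj[OF A] differing_ranks_commute[OF assms]
    by (auto simp: adjacent_iff_card_differing_ranks[OF assms])
qed

lemma flag_induct [consumes 2, case_names refl step]:
  assumes A: "A \<in> flags P" and B: "B \<in> flags P" and "Q A"
    and step: "\<And>C j. C \<in> flags P \<Longrightarrow> j < n \<Longrightarrow> Q C \<Longrightarrow> Q (flag_adj P j C)"
  shows "Q B"
proof -
  have "(A, B) \<in> {(C, D). C \<in> flags P \<and> D \<in> flags P \<and> adjacent C D \<and> A \<inter> B \<subseteq> C \<and> A \<inter> B \<subseteq> D}\<^sup>*"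
    using flag_connected A B by (simp add: strongly_flag_connected_def)
  then show ?thesis
    by (induction rule: rtrancl_induct) (use \<open>Q A\<close> step adjacent_iff_flag_adj in blast)+
qed

end

section \<open>Automorphisms and rotations\<close>

lemma aut_group_simps:
  "carrier (aut_group P) = {f \<in> Bij (faces P). \<forall>F \<in> faces P. \<forall>G \<in> faces P.
      (F, G) \<in> face_le P \<longleftrightarrow> (f F, f G) \<in> face_le P}"
  "f \<otimes>\<^bsub>aut_group P\<^esub> g = compose (faces P) g f"
  "\<one>\<^bsub>aut_group P\<^esub> = (\<lambda>F \<in> faces P. F)"
  by (simp_all add: aut_group_def)

lemma
  assumes "f \<in> carrier (aut_group P)"
  shows aut_Bij: "f \<in> Bij (faces P)"
    and aut_faces: "F \<in> faces P \<Longrightarrow> f F \<in> faces P"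
    and aut_inj_on: "inj_on f (faces P)"
    and aut_le_iff: "F \<in> faces P \<Longrightarrow> G \<in> faces P \<Longrightarrow> (f F, f G) \<in> face_le P \<longleftrightarrow> (F, G) \<in> face_le P"
  using assms by (auto simp: aut_group_simps Bij_def bij_betw_def)

lemma aut_inv_into:
  assumes f: "f \<in> carrier (aut_group P)"
  shows "(\<lambda>F \<in> faces P. inv_into (faces P) f F) \<in> carrier (aut_group P)"
proof -
  let ?g = "inv_into (faces P) f"
  have "?g F \<in> faces P" "f (?g F) = F" if "F \<in> faces P" for F
    using that aut_Bij[OF f] by (auto simp: Bij_def bij_betw_def f_inv_into_f inv_into_into)
  then have "(F, G) \<in> face_le P \<longleftrightarrow> (?g F, ?g G) \<in> face_le P" if "F \<in> faces P" "G \<in> faces P" for F G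
    using that aut_le_iff[OF f, of "?g F" "?g G"] by simp
  then show ?thesis using restrict_inv_into_Bij[OF aut_Bij[OF f]] by (simp add: aut_group_simps)
qed

lemma group_aut_group: "group (aut_group P)"
proof (rule groupI)
  fix f g assume fg: "f \<in> carrier (aut_group P)" "g \<in> carrier (aut_group P)"
  then have "compose (faces P) g f \<in> Bij (faces P)" by (intro compose_Bij aut_Bij)
  moreover have "(F, G) \<in> face_le P \<longleftrightarrow> (g (f F), g (f G)) \<in> face_le P"
    if "F \<in> faces P" "G \<in> faces P" for F G
    using that aut_faces[OF fg(1)] aut_le_iff[OF fg(1)] aut_le_iff[OF fg(2)] by simp
  ultimately show "f \<otimes>\<^bsub>aut_group P\<^esub> g \<in> carrier (aut_group P)"
    by (simp add: aut_group_simps compose_eq)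
next
  show "\<one>\<^bsub>aut_group P\<^esub> \<in> carrier (aut_group P)"
    by (auto simp: aut_group_simps id_Bij)
next
  fix f g h assume f: "f \<in> carrier (aut_group P)"
  show "f \<otimes>\<^bsub>aut_group P\<^esub> g \<otimes>\<^bsub>aut_group P\<^esub> h = f \<otimes>\<^bsub>aut_group P\<^esub> (g \<otimes>\<^bsub>aut_group P\<^esub> h)"
    using compose_assoc[OF Bij_imp_funcset[OF aut_Bij[OF f]]] by (simp add: aut_group_simps(2))
next
  fix f assume f: "f \<in> carrier (aut_group P)"
  then show "\<one>\<^bsub>aut_group P\<^esub> \<otimes>\<^bsub>aut_group P\<^esub> f = f"
    using compose_Id[OF Bij_imp_funcset Bij_imp_extensional] aut_Bij[OF f]
    by (simp add: aut_group_simps(2,3))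
  have "(\<lambda>F \<in> faces P. inv_into (faces P) f F) \<otimes>\<^bsub>aut_group P\<^esub> f = \<one>\<^bsub>aut_group P\<^esub>"
    using aut_Bij[OF f]
    by (simp add: aut_group_simps(2,3) compose_id_inv_into Bij_def bij_betw_imp_surj_on)
  then show "\<exists>g \<in> carrier (aut_group P). g \<otimes>\<^bsub>aut_group P\<^esub> f = \<one>\<^bsub>aut_group P\<^esub>"
    using aut_inv_into[OF f] by blast
qed

lemma aut_mult_image: "A \<subseteq> faces P \<Longrightarrow> (f \<otimes>\<^bsub>aut_group P\<^esub> g) ` A = g ` (f ` A)"
  by (auto simp: aut_group_simps compose_def)

lemma aut_one_image: "A \<subseteq> faces P \<Longrightarrow> \<one>\<^bsub>aut_group P\<^esub> ` A = A"
  by (auto simp: aut_group_simps)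

lemma aut_inv_image:
  assumes f: "f \<in> carrier (aut_group P)" and A: "A \<subseteq> faces P"
  shows "(inv\<^bsub>aut_group P\<^esub> f) ` (f ` A) = A"
proof -
  interpret group "aut_group P" by (rule group_aut_group)
  show ?thesis using aut_mult_image[OF A, of f "inv\<^bsub>aut_group P\<^esub> f"] aut_one_image[OF A] f by simp
qed

context abstract_polytope
begin

lemma aut_less_iff:
  assumes "f \<in> carrier (aut_group P)" and "F \<in> faces P" and "G \<in> faces P"
  shows "face_less P (f F) (f G) \<longleftrightarrow> face_less P F G"
  using aut_le_iff[OF assms] inj_on_eq_iff[OF aut_inj_on[OF assms(1)] assms(2,3)]
  by (simp add: face_less_def)

lemma aut_flag:
  assumes f: "f \<in> carrier (aut_group P)" and \<Psi>: "\<Psi> \<in> flags P"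
  shows "f ` \<Psi> \<in> flags P"
proof (rule flagI)
  show "f ` \<Psi> \<in> Chains (face_le P)"
    using flag_chain[OF \<Psi>] flag_faces[OF \<Psi>] aut_le_iff[OF f] by (auto simp: Chains_def subset_iff)
  show "card (f ` \<Psi>) = n + 2"
    using card_image[OF inj_on_subset[OF aut_inj_on[OF f] flag_faces[OF \<Psi>]]] card_flag[OF \<Psi>] by simp
qed

lemma card_below_in_flag:
  assumes \<Psi>: "\<Psi> \<in> flags P" and F: "F \<in> \<Psi>"
  shows "int (card {G \<in> \<Psi>. face_less P G F}) = rk P F + 1"
proof -
  have F_rk: "-1 \<le> rk P F" "rk P F \<le> int n" using F flag_faces[OF \<Psi>] rk_bounds by fastforce+
  let ?below = "{G \<in> \<Psi>. rk P G < rk P F}"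
  have "{G \<in> \<Psi>. face_less P G F} = ?below"
    using chain_less[OF flag_chain[OF \<Psi>] _ F] rk_strict_mono by blast
  moreover have "card ?below = card (rk P ` ?below)"
    using inj_on_subset[OF inj_on_rk_chain[OF flag_chain[OF \<Psi>]]]
    by (intro card_image[symmetric]) auto
  moreover have "rk P ` ?below = {r \<in> rk P ` \<Psi>. r < rk P F}" by auto
  moreover have "\<dots> = {-1..<rk P F}"
    using F_rk by (auto simp: rk_image_flag[OF \<Psi>])
  ultimately have "card {G \<in> \<Psi>. face_less P G F} = card {-1..<rk P F}" by simp
  then show ?thesis using F_rk by simp
qed

lemma aut_rk:
  assumes f: "f \<in> carrier (aut_group P)" and F: "F \<in> faces P"
  shows "rk P (f F) = rk P F"
proof -
  obtain \<Psi> where \<Psi>: "\<Psi> \<in> flags P" "F \<in> \<Psi>" using face_in_flag[OF F] .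
  have below: "{G \<in> \<Psi>. face_less P G F} \<subseteq> faces P" using flag_faces[OF \<Psi>(1)] by blast
  have "{G \<in> f ` \<Psi>. face_less P G (f F)} = f ` {G \<in> \<Psi>. face_less P G F}"
    using aut_less_iff[OF f _ F] flag_faces[OF \<Psi>(1)] by auto
  then have "card {G \<in> f ` \<Psi>. face_less P G (f F)} = card {G \<in> \<Psi>. face_less P G F}"
    using card_image[OF inj_on_subset[OF aut_inj_on[OF f] below]] by simp
  then show ?thesis
    using card_below_in_flag[OF \<Psi>] card_below_in_flag[OF aut_flag[OF f \<Psi>(1)], of "f F"] \<Psi>(2) by simp
qed

lemma differing_ranks_aut:
  assumes f: "f \<in> carrier (aut_group P)" and "A \<subseteq> faces P" and "B \<subseteq> faces P"
  shows "differing_ranks P (f ` A) (f ` B) = differing_ranks P A B"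
proof -
  have "f ` A - f ` B = f ` (A - B)"
    using assms(2,3) by (intro inj_on_image_set_diff[OF aut_inj_on[OF f], symmetric]) auto
  then show ?thesis
    using aut_rk[OF f] assms(2) by (auto simp: differing_ranks_def image_image intro!: image_cong)
qed

lemma aut_flag_adj:
  assumes f: "f \<in> carrier (aut_group P)" and \<Psi>: "\<Psi> \<in> flags P" and j: "j < n"
  shows "flag_adj P j (f ` \<Psi>) = f ` flag_adj P j \<Psi>"
  using assms by (intro flag_adj_eqI)
    (auto simp: aut_flag flag_adj_flag flag_faces differing_ranks_aut differing_ranks_flag_adj)

lemma aut_word_act:
  assumes f: "f \<in> carrier (aut_group P)" and w: "w \<in> words {1..<n}" and \<Psi>: "\<Psi> \<in> flags P"
  shows "word_act (flag_adj P) w (f ` \<Psi>) = f ` word_act (flag_adj P) w \<Psi>"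
  using w
proof (induction w)
  case (Cons l w)
  then show ?case
    using word_act_closed[of w \<Psi>] \<Psi>
    by (cases l) (simp add: aut_flag_adj[OF f] flag_adj_flag less_imp_diff_less)
qed simp

lemma aut_eqI:
  assumes f: "f \<in> carrier (aut_group P)" and g: "g \<in> carrier (aut_group P)"
    and \<Phi>: "\<Phi> \<in> flags P" and eq: "f ` \<Phi> = g ` \<Phi>"
  shows "f = g"
proof (rule extensionalityI)
  show "f \<in> extensional (faces P)" "g \<in> extensional (faces P)"
    using f g by (auto dest: aut_Bij Bij_imp_extensional)
  fix F assume F: "F \<in> faces P"
  then obtain \<Psi> where \<Psi>: "\<Psi> \<in> flags P" "F \<in> \<Psi>" by (rule face_in_flag)
  have images: "f ` \<Psi> = g ` \<Psi>"
    using \<Phi> \<Psi>(1)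
  proof (induction rule: flag_induct)
    case (step C j)
    then show ?case using aut_flag_adj[OF f, of C j] aut_flag_adj[OF g, of C j] by simp
  qed (rule eq)
  have "f F \<in> g ` \<Psi>" "g F \<in> g ` \<Psi>" using images \<Psi>(2) by auto
  then show "f F = g F"
    using flag_face_eqI[OF aut_flag[OF g \<Psi>(1)]] aut_rk[OF f F] aut_rk[OF g F] by simp
qed

lemma base_to_eqI:
  assumes "f \<in> carrier (aut_group P)" and "f ` base P = \<Psi>"
  shows "base_to P \<Psi> = f"
  unfolding base_to_def using assms aut_eqI[OF _ _ base_flag] by (intro the_equality) auto

end

locale rotary_polytope = abstract_polytope +
  assumes two_step_orbit: "\<Psi> \<in> flags P \<Longrightarrow> i < n \<Longrightarrow> j < n \<Longrightarrow>
    \<exists>f \<in> carrier (aut_group P). f ` \<Psi> = flag_adj P j (flag_adj P i \<Psi>)"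

lemma rotary_polytope_if_regular:
  assumes "polytope n P" and "regular P"
  shows "rotary_polytope n P"
proof -
  interpret abstract_polytope n P by unfold_locales fact
  show ?thesis
    using assms(2) by unfold_locales (auto simp: regular_def flag_adj_flag)
qed

lemma rotary_polytope_if_directly_regular:
  "directly_regular_polytope n P \<Longrightarrow> rotary_polytope n P"
  by (simp add: directly_regular_polytope_def rotary_polytope_if_regular)

lemma rotary_polytope_if_chiral:
  assumes P: "chiral_polytope n P"
  shows "rotary_polytope n P"
proof -
  interpret abstract_polytope n P using P by unfold_locales (simp add: chiral_polytope_def)
  interpret A: group "aut_group P" by (rule group_aut_group)
  let ?o = "orbit (aut_group P) (`)"
  show ?thesis
  proof
    fix \<Psi> i j assume \<Psi>: "\<Psi> \<in> flags P" and i: "i < n" and j: "j < n"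
    let ?A = "flag_adj P i \<Psi>" and ?B = "flag_adj P j (flag_adj P i \<Psi>)"
    have A: "?A \<in> flags P" and B: "?B \<in> flags P" using \<Psi> i j by (auto intro!: flag_adj_flag)
    have "adjacent \<Psi> ?A" "adjacent ?A ?B"
      using adjacent_iff_flag_adj \<Psi> A B i j by blast+
    then have neq: "?o \<Psi> \<noteq> ?o ?A" "?o ?A \<noteq> ?o ?B"
      using P \<Psi> A B unfolding chiral_polytope_def by blast+
    obtain X Y where orbits: "orbits (aut_group P) (flags P) (`) = {X, Y}"
      using P by (auto simp: chiral_polytope_def card_2_iff)
    have "?o \<Psi> \<in> {X, Y}" "?o ?A \<in> {X, Y}" "?o ?B \<in> {X, Y}"
      using \<Psi> A B unfolding orbits[symmetric] orbits_def by blast+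
    then have "?o \<Psi> = ?o ?B" using neq by auto
    moreover have "?B \<in> ?o ?B"
      using A.one_closed aut_one_image[OF flag_faces[OF B]] unfolding orbit_def by force
    ultimately have "?B \<in> ?o \<Psi>" by simp
    then show "\<exists>f \<in> carrier (aut_group P). f ` \<Psi> = ?B" unfolding orbit_def by force
  qed
qed

lemma chiral_rank_pos:
  assumes "chiral_polytope n P"
  shows "0 < n"
proof (rule ccontr)
  assume "\<not> 0 < n"
  interpret abstract_polytope n P using assms by unfold_locales (simp add: chiral_polytope_def)
  have "B = base P" if "B \<in> flags P" for B
    using base_flag that by (induction rule: flag_induct) (use \<open>\<not> 0 < n\<close> in auto)
  then have "orbits (aut_group P) (flags P) (`) \<subseteq> {orbit (aut_group P) (`) (base P)}"
    by (auto simp: orbits_def)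
  then have "card (orbits (aut_group P) (flags P) (`)) \<le> 1"
    by (auto dest: card_mono[rotated])
  then show False using assms by (simp add: chiral_polytope_def)
qed

context rotary_polytope
begin

lemma
  assumes "regular P" and j: "j < n"
  shows rho_aut: "rho P j \<in> carrier (aut_group P)"
    and rho_base: "rho P j ` base P = flag_adj P j (base P)"
proof -
  obtain f where "f \<in> carrier (aut_group P)" "f ` base P = flag_adj P j (base P)"
    using assms base_flag flag_adj_flag[OF base_flag j] unfolding regular_def by blast
  then show "rho P j \<in> carrier (aut_group P)" "rho P j ` base P = flag_adj P j (base P)"
    using base_to_eqI[of f] by (simp_all add: rho_def)
qed

lemma
  assumes i: "i \<in> {1..<n}"
  shows sigma_aut: "sigma P i \<in> carrier (aut_group P)" (is ?aut)
    and sigma_base: "sigma P i ` base P = flag_adj P (i - 1) (flag_adj P i (base P))" (is ?base)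
proof -
  have ranks: "i < n" "i - 1 < n" using i by auto
  have "?aut \<and> ?base"
  proof (cases "regular P")
    case True
    interpret A: group "aut_group P" by (rule group_aut_group)
    note rho = rho_aut[OF True] rho_base[OF True]
    have "(rho P (i - 1) \<otimes>\<^bsub>aut_group P\<^esub> rho P i) ` base P = rho P i ` flag_adj P (i - 1) (base P)"
      using ranks by (simp add: aut_mult_image[OF flag_faces[OF base_flag]] rho)
    also have "\<dots> = flag_adj P (i - 1) (flag_adj P i (base P))"
      using ranks by (simp add: aut_flag_adj[symmetric] rho base_flag)
    finally show ?thesis using True ranks by (simp add: sigma_def rho)
  next
    case False
    obtain f where "f \<in> carrier (aut_group P)"
      "f ` base P = flag_adj P (i - 1) (flag_adj P i (base P))"
      using two_step_orbit[OF base_flag ranks] by blast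
    then show ?thesis using base_to_eqI[of f] False by (simp add: sigma_def)
  qed
  then show ?aut and ?base by auto
qed

lemma sigma_letter_base:
  assumes i: "i \<in> {1..<n}"
  shows "(if b then sigma P i else inv\<^bsub>aut_group P\<^esub> (sigma P i)) ` base P =
    word_act (flag_adj P) [(i, b)] (base P)"
proof (cases b)
  case True
  then show ?thesis using sigma_base[OF i] by simp
next
  case False
  have ranks: "i < n" "i - 1 < n" using i by auto
  let ?B = "flag_adj P i (flag_adj P (i - 1) (base P))"
  have B: "?B \<in> flags P" using ranks base_flag by (simp add: flag_adj_flag)
  have "sigma P i ` ?B = base P"
    using ranks base_flag sigma_base[OF i]
    by (simp add: aut_flag_adj[OF sigma_aut[OF i], symmetric] flag_adj_flag flag_adj_flag_adj)
  then show ?thesis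
    using aut_inv_image[OF sigma_aut[OF i] flag_faces[OF B]] False by simp
qed

text \<open>Automorphisms act from the right and commute with words, which act from the left, so both
  sides read the word in the same order.\<close>

lemma word_eval_sigma_base:
  assumes "w \<in> words {1..<n}"
  shows "word_eval (aut_group P) (sigma P) w ` base P = word_act (flag_adj P) w (base P)"
  using assms
proof (induction w)
  case Nil
  then show ?case by (simp add: aut_one_image[OF flag_faces[OF base_flag]])
next
  case (Cons l w)
  interpret A: group "aut_group P" by (rule group_aut_group)
  obtain i b where l: "l = (i, b)" by force
  have i: "[(i, b)] \<in> words {1..<n}" and w: "w \<in> words {1..<n}" using Cons.prems l by auto
  let ?g = "word_eval (aut_group P) (sigma P) w"
  have g: "?g \<in> carrier (aut_group P)" using w sigma_aut by (rule A.word_eval_closed)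
  have "word_eval (aut_group P) (sigma P) (l # w) ` base P =
      ?g ` word_act (flag_adj P) [(i, b)] (base P)"
    using i sigma_letter_base[of i b] by (simp add: l aut_mult_image[OF flag_faces[OF base_flag]])
  also have "\<dots> = word_act (flag_adj P) [(i, b)] (word_act (flag_adj P) w (base P))"
    using aut_word_act[OF g i base_flag] Cons.IH[OF w] by simp
  finally show ?case by (simp add: l)
qed

lemma word_eval_sigma_eq_one_iff:
  assumes w: "w \<in> words {1..<n}"
  shows "word_eval (aut_group P) (sigma P) w = \<one>\<^bsub>aut_group P\<^esub> \<longleftrightarrow>
    word_act (flag_adj P) w (base P) = base P"
proof -
  interpret A: group "aut_group P" by (rule group_aut_group)
  have "word_eval (aut_group P) (sigma P) w \<in> carrier (aut_group P)"
    using w sigma_aut by (rule A.word_eval_closed)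
  then show ?thesis
    using aut_eqI[OF _ A.one_closed base_flag] word_eval_sigma_base[OF w]
      aut_one_image[OF flag_faces[OF base_flag]] by metis
qed

sublocale sigma: relations_hold "{1..<n}" "W_relators n" "aut_group P" "sigma P"
proof -
  interpret A: group "aut_group P" by (rule group_aut_group)
  show "relations_hold {1..<n} (W_relators n) (aut_group P) (sigma P)"
    using W.relators_in_words[of n] word_act_relator base_flag
    by unfold_locales (auto simp: sigma_aut word_eval_sigma_eq_one_iff)
qed

lemma sigma_rot_group: "i \<in> {1..<n} \<Longrightarrow> sigma P i \<in> carrier (rot_group n P)"
  by (auto simp: rot_group_def sigma_aut intro: generate.incl)

lemma subgroup_rot_group: "subgroup (carrier (rot_group n P)) (aut_group P)"
  using sigma_aut
  by (auto simp: rot_group_def sigma.G.subgroup_self intro!: sigma.G.generate_is_subgroup)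

lemma rot_group_eq: "rot_group n P = (aut_group P)\<lparr>carrier := carrier (rot_group n P)\<rparr>"
  by (simp add: rot_group_def)

lemma relations_hold_rot_group:
  "relations_hold {1..<n} (W_relators n) (rot_group n P) (sigma P)"
  using sigma.relations_hold_subgroup[OF subgroup_rot_group sigma_rot_group] rot_group_eq by simp

end

text \<open>If \<open>\<Gamma>\<^sup>+(P) = W\<^sup>+ / M\<close>, this is \<open>M\<close>.\<close>

definition rotation_kernel :: "nat \<Rightarrow> 'a based_poset \<Rightarrow> word set set" where
  "rotation_kernel n P = kernel (W n) (rot_group n P) (gen_hom (rot_group n P) (sigma P))"

lemma rotation_kernel_subset: "rotation_kernel n P \<subseteq> carrier (W n)"
  by (auto simp: rotation_kernel_def kernel_def)

lemma (in rotary_polytope) rotation_kernel_eq: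
  "rotation_kernel n P =
    {W_class n w | w. w \<in> words {1..<n} \<and> word_act (flag_adj P) w (base P) = base P}"
proof -
  have "rotation_kernel n P = kernel (W n) (aut_group P) (gen_hom (aut_group P) (sigma P))"
    using sigma.kernel_gen_hom_subgroup[OF subgroup_rot_group sigma_rot_group] rot_group_eq
    by (simp add: rotation_kernel_def W_def)
  also have "\<dots> = {W_class n w | w. w \<in> words {1..<n} \<and> word_act (flag_adj P) w (base P) = base P}"
    using sigma.kernel_gen_hom word_eval_sigma_eq_one_iff by (auto simp: W_def)
  finally show ?thesis .
qed

lemma mix_eq_Int_rotation_kernel:
  assumes "rotary_polytope n P" and "rotary_polytope n Q"
  shows "mix n P Q = rotation_kernel n P \<inter> rotation_kernel n Q"
proof -
  interpret P: rotary_polytope n P by fact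
  interpret Q: rotary_polytope n Q by fact
  let ?D = "rot_group n P \<times>\<times> rot_group n Q"
  have gens: "mix_gen P Q = (\<lambda>i. (sigma P i, sigma Q i))" by (simp add: mix_gen_def fun_eq_iff)
  note models = P.relations_hold_rot_group Q.relations_hold_rot_group
  interpret D: relations_hold "{1..<n}" "W_relators n" ?D "mix_gen P Q"
    unfolding gens by (rule relations_hold_DirProd[OF models])
  have "subgroup (generate ?D (mix_gen P Q ` {1..<n})) ?D"
    using D.gen_closed by (intro D.G.generate_is_subgroup) blast
  then have "mix n P Q = kernel (W n) ?D (gen_hom ?D (mix_gen P Q))"
    unfolding mix_def mix_group_def W_def
    by (rule D.kernel_gen_hom_subgroup) (auto intro: generate.incl)
  also have "\<dots> = rotation_kernel n P \<inter> rotation_kernel n Q"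
    using kernel_gen_hom_DirProd[OF models] by (simp add: gens rotation_kernel_def W_def)
  finally show ?thesis .
qed

section \<open>Duals and mirror images\<close>

lemma dual_simps [simp]:
  "face_le (dual n P) = (face_le P)\<inverse>" "rk (dual n P) F = int n - 1 - rk P F"
  "base (dual n P) = base P"
  by (simp_all add: dual_def)

lemma mirror_simps [simp]:
  "face_le (mirror P) = face_le P" "rk (mirror P) = rk P"
  "base (mirror P) = flag_adj P 0 (base P)"
  by (simp_all add: mirror_def)

lemma faces_dual [simp]: "faces (dual n P) = faces P"
  and faces_mirror [simp]: "faces (mirror P) = faces P"
  by (simp_all add: faces_def)

lemma flags_dual [simp]: "flags (dual n P) = flags P"
  and flags_mirror [simp]: "flags (mirror P) = flags P"
proof -
  have "Chains ((face_le P)\<inverse>) = Chains (face_le P)" by (auto simp: Chains_def)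
  then show "flags (dual n P) = flags P" by (simp add: flags_def)
qed (simp add: flags_def)

lemma aut_group_dual [simp]: "aut_group (dual n P) = aut_group P"
  and aut_group_mirror [simp]: "aut_group (mirror P) = aut_group P"
  by (auto simp: aut_group_def)

lemma flag_adj_mirror [simp]: "flag_adj (mirror P) = flag_adj P"
  by (simp add: flag_adj_def fun_eq_iff)

lemma flag_adj_dual:
  assumes "j < n"
  shows "flag_adj (dual n P) j = flag_adj P (n - 1 - j)"
proof -
  have "rk (dual n P) F \<noteq> int j \<longleftrightarrow> rk P F \<noteq> int (n - 1 - j)" for F
    using assms by auto
  then show ?thesis by (simp add: flag_adj_def fun_eq_iff)
qed

lemma dual_dual [simp]: "dual n (dual n P) = P"
  by (simp add: dual_def)

lemma (in abstract_polytope) mirror_mirror: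
  assumes "0 < n"
  shows "mirror (mirror P) = P"
  using flag_adj_flag_adj[OF base_flag assms] by (intro based_poset.equality) simp_all

lemma face_less_dual [simp]: "face_less (dual n P) F G \<longleftrightarrow> face_less P G F"
  and face_less_mirror [simp]: "face_less (mirror P) = face_less P"
  by (auto simp: face_less_def fun_eq_iff)

lemma strongly_flag_connected_dual [simp]:
    "strongly_flag_connected (dual n P) = strongly_flag_connected P"
  and strongly_flag_connected_mirror [simp]:
    "strongly_flag_connected (mirror P) = strongly_flag_connected P"
  by (simp_all add: strongly_flag_connected_def)

lemma polytope_dual:
  assumes "polytope n P"
  shows "polytope n (dual n P)"
proof -
  interpret abstract_polytope n P by unfold_locales fact
  let ?rk = "rk (dual n P)" and ?less = "face_less (dual n P)"
  have "card {H. ?rk H = ?rk F + 1 \<and> ?less F H \<and> ?less H G} = 2"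
    if "?less F G" "?rk G = ?rk F + 2" for F G
  proof -
    have "{H. ?rk H = ?rk F + 1 \<and> ?less F H \<and> ?less H G} =
        {H. rk P H = rk P G + 1 \<and> face_less P G H \<and> face_less P H F}"
      using that by auto
    then show ?thesis using diamond[of G F] that by simp
  qed
  moreover have "- 1 \<le> ?rk F \<and> ?rk F \<le> int n" if "F \<in> faces P" for F
    using rk_bounds[OF that] by auto
  moreover have "?rk F < ?rk G" if "?less F G" for F G
    using rk_strict_mono[of G F] that by simp
  moreover have "?rk F = - 1 \<longleftrightarrow> rk P F = int n" "?rk F = int n \<longleftrightarrow> rk P F = - 1" for F
    by auto
  ultimately show ?thesis
    using assms unfolding polytope_def by (simp del: dual_simps(2))
qed

lemma polytope_mirror:
  assumes "polytope n P" and "0 < n"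
  shows "polytope n (mirror P)"
proof -
  interpret abstract_polytope n P by unfold_locales fact
  show ?thesis using assms flag_adj_flag[OF base_flag, of 0] by (simp add: polytope_def)
qed

context rotary_polytope
begin

lemma rotary_polytope_dual: "rotary_polytope n (dual n P)"
proof -
  interpret D: abstract_polytope n "dual n P"
    by unfold_locales (rule polytope_dual[OF polytope])
  show ?thesis
    by unfold_locales (simp add: flag_adj_dual two_step_orbit)
qed

lemma rotary_polytope_mirror:
  assumes "0 < n"
  shows "rotary_polytope n (mirror P)"
proof -
  interpret M: abstract_polytope n "mirror P"
    by unfold_locales (rule polytope_mirror[OF polytope assms])
  show ?thesis
    by unfold_locales (simp add: two_step_orbit)
qed

lemma struct_dual_rotation_kernel_subset:
  "struct_dual n (rotation_kernel n P) \<subseteq> rotation_kernel n (dual n P)"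
proof -
  interpret D: rotary_polytope n "dual n P" by (rule rotary_polytope_dual)
  have dual_action: "string_coxeter_action (flags P) n (flag_adj (dual n P))"
    using D.string_coxeter_action_axioms by simp
  have "word_act (flag_adj (dual n P)) (delta_word n w) (base P) = word_act (flag_adj P) w (base P)"
    if "w \<in> words {1..<n}" for w
    by (rule word_act_delta_word[OF dual_action string_coxeter_action_axioms _ that base_flag])
      (simp add: flag_adj_dual)
  then show ?thesis
    unfolding rotation_kernel_eq D.rotation_kernel_eq struct_dual_def
    by (auto simp: W_delta_W_class) (use delta_word_in_words in blast)
qed

lemma struct_mirror_rotation_kernel_subset:
  assumes n: "0 < n"
  shows "struct_mirror n (rotation_kernel n P) \<subseteq> rotation_kernel n (mirror P)"
proof -
  interpret M: rotary_polytope n "mirror P" by (rule rotary_polytope_mirror[OF n])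
  show ?thesis
    using word_act_bar_word[OF n _ base_flag] bar_word_in_words
    unfolding M.rotation_kernel_eq rotation_kernel_eq struct_mirror_def
    by (fastforce simp: W_bar_W_class)
qed

lemma rotation_kernel_dual: "rotation_kernel n (dual n P) = struct_dual n (rotation_kernel n P)"
proof
  interpret D: rotary_polytope n "dual n P" by (rule rotary_polytope_dual)
  have "struct_dual n (rotation_kernel n (dual n P)) \<subseteq> rotation_kernel n P"
    using D.struct_dual_rotation_kernel_subset by simp
  then have "struct_dual n (struct_dual n (rotation_kernel n (dual n P)))
      \<subseteq> struct_dual n (rotation_kernel n P)"
    unfolding struct_dual_def by (rule image_mono)
  then show "rotation_kernel n (dual n P) \<subseteq> struct_dual n (rotation_kernel n P)"
    by (simp add: struct_dual_struct_dual rotation_kernel_subset)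
qed (rule struct_dual_rotation_kernel_subset)

lemma rotation_kernel_mirror:
  assumes n: "0 < n"
  shows "rotation_kernel n (mirror P) = struct_mirror n (rotation_kernel n P)"
proof
  interpret M: rotary_polytope n "mirror P" by (rule rotary_polytope_mirror[OF n])
  have "struct_mirror n (rotation_kernel n (mirror P)) \<subseteq> rotation_kernel n P"
    using M.struct_mirror_rotation_kernel_subset[OF n] mirror_mirror[OF n] by simp
  then have "struct_mirror n (struct_mirror n (rotation_kernel n (mirror P)))
      \<subseteq> struct_mirror n (rotation_kernel n P)"
    unfolding struct_mirror_def by (rule image_mono)
  then show "rotation_kernel n (mirror P) \<subseteq> struct_mirror n (rotation_kernel n P)"
    by (simp add: struct_mirror_struct_mirror rotation_kernel_subset)
qed (rule struct_mirror_rotation_kernel_subset[OF n])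

end

lemma rotation_kernel_eq_if_same_orbit:
  assumes P: "rotary_polytope n P" and Q: "rotary_polytope n Q"
    and adj: "flag_adj P = flag_adj Q"
    and f: "f \<in> carrier (aut_group P)" "f ` base P = base Q"
  shows "rotation_kernel n P = rotation_kernel n Q"
proof -
  interpret P: rotary_polytope n P by fact
  interpret Q: rotary_polytope n Q by fact
  have "word_act (flag_adj Q) w (base Q) = base Q \<longleftrightarrow> word_act (flag_adj P) w (base P) = base P"
    if w: "w \<in> words {1..<n}" for w
  proof -
    have "word_act (flag_adj Q) w (base Q) = f ` word_act (flag_adj P) w (base P)"
      using P.aut_word_act[OF f(1) w P.base_flag] by (simp add: adj f(2))
    moreover have "f ` word_act (flag_adj P) w (base P) = f ` base P \<longleftrightarrow>
        word_act (flag_adj P) w (base P) = base P"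
      using P.word_act_closed[OF w P.base_flag] P.base_flag
      by (intro inj_on_image_eq_iff[OF aut_inj_on[OF f(1)]] P.flag_faces)
    ultimately show ?thesis using f(2) by simp
  qed
  then show ?thesis unfolding P.rotation_kernel_eq Q.rotation_kernel_eq by blast
qed

lemma (in rotary_polytope) struct_dual_struct_mirror_rotation_kernel:
  assumes n: "0 < n"
  shows "struct_dual n (struct_mirror n (rotation_kernel n P)) =
    struct_mirror n (struct_dual n (rotation_kernel n P))"
proof -
  interpret D: rotary_polytope n "dual n P" by (rule rotary_polytope_dual)
  interpret M: rotary_polytope n "mirror P" by (rule rotary_polytope_mirror[OF n])
  have "flag_adj P 0 (base P) \<in> flags P" using n base_flag by (simp add: flag_adj_flag)
  then obtain f where "f \<in> carrier (aut_group P)"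
    "f ` flag_adj P 0 (base P) = flag_adj P (n - 1) (flag_adj P 0 (flag_adj P 0 (base P)))"
    using two_step_orbit[of "flag_adj P 0 (base P)" 0 "n - 1"] n by auto
  then have f: "f \<in> carrier (aut_group (dual n (mirror P)))"
    "f ` base (dual n (mirror P)) = base (mirror (dual n P))"
    using n base_flag by (simp_all add: flag_adj_flag_adj flag_adj_dual)
  have "flag_adj (dual n (mirror P)) = flag_adj (mirror (dual n P))"
    by (simp add: flag_adj_def fun_eq_iff)
  with f have "rotation_kernel n (dual n (mirror P)) = rotation_kernel n (mirror (dual n P))"
    by (intro rotation_kernel_eq_if_same_orbit M.rotary_polytope_dual D.rotary_polytope_mirror[OF n])
  then show ?thesis
    using n by (simp add: M.rotation_kernel_dual D.rotation_kernel_mirror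
        rotation_kernel_dual rotation_kernel_mirror)
qed

section \<open>Self-duality of mixes\<close>

context rotary_polytope
begin

lemma properly_self_dual_mix_dual: "properly_self_dual n (mix n P (dual n P))"
proof -
  let ?K = "rotation_kernel n P"
  have mix: "mix n P (dual n P) = ?K \<inter> struct_dual n ?K"
    using mix_eq_Int_rotation_kernel[OF rotary_polytope_axioms rotary_polytope_dual]
    by (simp add: rotation_kernel_dual)
  have "struct_dual n (?K \<inter> struct_dual n ?K) = struct_dual n ?K \<inter> ?K"
    by (simp add: rotation_kernel_subset struct_dual_subset struct_dual_Int struct_dual_struct_dual)
  then show ?thesis by (simp add: properly_self_dual_def mix Int_commute)
qed

lemma struct_mirror_struct_dual_mix:
  assumes n: "0 < n"
  defines "Q \<equiv> mix n P (mirror (dual n P))"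
  shows "struct_mirror n (struct_dual n Q) = Q"
proof -
  interpret D: rotary_polytope n "dual n P" by (rule rotary_polytope_dual)
  let ?K = "rotation_kernel n P" and ?\<delta> = "struct_dual n" and ?\<mu> = "struct_mirror n"
  have K: "?K \<subseteq> carrier (W n)" "?\<mu> ?K \<subseteq> carrier (W n)"
    using rotation_kernel_subset[of n P] rotation_kernel_subset[of n "mirror P"]
    by (simp_all add: rotation_kernel_mirror[OF n])
  have Q: "Q = ?K \<inter> ?\<delta> (?\<mu> ?K)"
    unfolding Q_def
    using mix_eq_Int_rotation_kernel[OF rotary_polytope_axioms D.rotary_polytope_mirror[OF n]]
    by (simp add: D.rotation_kernel_mirror[OF n] rotation_kernel_dual
        struct_dual_struct_mirror_rotation_kernel[OF n])
  have "?\<mu> (?\<delta> Q) = ?\<mu> (?\<delta> ?K \<inter> ?\<mu> ?K)"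
    by (simp add: Q K struct_dual_subset struct_dual_Int struct_dual_struct_dual)
  also have "\<dots> = ?\<delta> (?\<mu> ?K) \<inter> ?K"
    by (simp add: K struct_dual_subset struct_mirror_Int struct_mirror_struct_mirror
        struct_dual_struct_mirror_rotation_kernel[OF n])
  finally show ?thesis by (simp add: Q Int_commute)
qed

end

theorem mainTheorem6:
  fixes n :: nat and P :: "'a based_poset"
  shows "(chiral_polytope n P \<or> directly_regular_polytope n P \<longrightarrow>
            properly_self_dual n (mix n P (dual n P))) \<and>
         (chiral_polytope n P \<longrightarrow>
            (let Q = mix n P (mirror (dual n P)) in
               Q = struct_mirror n (struct_dual n Q) \<and>
               (struct_directly_regular n Q \<longrightarrow> properly_self_dual n Q) \<and>
               (struct_chiral n Q \<longrightarrow> improperly_self_dual n Q)))"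
proof (intro conjI impI)
  assume "chiral_polytope n P \<or> directly_regular_polytope n P"
  then show "properly_self_dual n (mix n P (dual n P))"
    by (blast intro: rotary_polytope.properly_self_dual_mix_dual rotary_polytope_if_chiral
        rotary_polytope_if_directly_regular)
next
  assume P: "chiral_polytope n P"
  define Q where "Q = mix n P (mirror (dual n P))"
  have Q: "struct_mirror n (struct_dual n Q) = Q"
    unfolding Q_def using P
    by (intro rotary_polytope.struct_mirror_struct_dual_mix rotary_polytope_if_chiral
        chiral_rank_pos)
  moreover have "Q \<subseteq> carrier (W n)" by (auto simp: Q_def mix_def kernel_def)
  ultimately have "struct_dual n Q = struct_mirror n Q"
    using struct_mirror_struct_mirror[OF struct_dual_subset] by metis
  then show "let Q = mix n P (mirror (dual n P)) in
       Q = struct_mirror n (struct_dual n Q) \<and>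
       (struct_directly_regular n Q \<longrightarrow> properly_self_dual n Q) \<and>
       (struct_chiral n Q \<longrightarrow> improperly_self_dual n Q)"
    using Q by (simp add: Q_def Let_def struct_directly_regular_def properly_self_dual_def
        improperly_self_dual_def)
qed

end
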